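(* Let $R$ be a commutative unital ring and let $B$ be a split sg-flavored $R$-bialgebra all of whose (nonzero) semigrouplike elements are grouplike. Let $I$ be the ideal spanned by $g-h$ for grouplike $g,h$, let $B^{\mathrm{red}}=B/I$ (a Hopf algebra), and let $\pi:B\to B^{\mathrm{red}}$ be the projection. The Brown map $$\Delta_B:B\to B\otimes_RB^{\mathrm{red}},\qquad\Delta_B(x)=\sum x^{(1)}\otimes\pi(x^{(2)})$$ (where $\Delta(x)=\sum x^{(1)}\otimes x^{(2)}$) is a Hopf coaction, i.e. a right coaction of the Hopf algebra $B^{\mathrm{red}}$ on $B$.
   Context: Algebras are unital, coalgebras counital over $R$. For submodules $M,N\subset C$ of a coalgebra, $M\boxtimes N\subset C\otimes C$ is the submodule of finite sums of $x\otimes y$, $x\in M,y\in N$. $\mathrm{sgpl}(C)$: nonzero $g$ with $\Delta(g)=g\otimes g$ (semigrouplike); grouplike means in addition $\epsilon(g)=1$. For $g,h\in\mathrm{sgpl}(C)$ put $\overline\Delta_{g,h}(x)=\Delta(x)-g\otimes x-x\otimes h$; simultaneously for all pairs, $F^Q_0C_{g,h}=Rg\cap Rh$ and, for $n\geq1$, $F^Q_nC_{g,h}=\{x\in C\mid\overline\Delta_{g,h}(x)\in\sum_{t\in\mathrm{sgpl}(C)}F^Q_{n-1}C_{g,t}\boxtimes F^Q_{n-1}C_{t,h}\}$; $F^{Q_{\bullet\bullet}}_nC=\sum_{g,h}F^Q_nC_{g,h}$. $C$ is sg-flavored if $C=\bigcup_nF^{Q_{\bullet\bullet}}_nC$, and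 split if moreover $F^{Q_{\bullet\bullet}}_0C$ is a direct summand of the $R$-module $C$. A bialgebra is (split) sg-flavored if its coalgebra is. *)

theory Defs
  imports "HOL-Algebra.Module" "HOL-Algebra.QuotRing"
begin

section \<open>Modules and associative algebras over a commutative ring\<close>

text \<open>
  The locale \<^locale>\<open>algebra\<close> of the library is restricted to commutative algebras, so the
  associative unital (not necessarily commutative) version is introduced here.
\<close>

locale assoc_algebra = module R A + A?: ring A for R (structure) and A (structure) +
  assumes smult_mult_left:
      "\<lbrakk>a \<in> carrier R; x \<in> carrier A; y \<in> carrier A\<rbrakk> \<Longrightarrow>
        (a \<odot>\<^bsub>A\<^esub> x) \<otimes>\<^bsub>A\<^esub> y = a \<odot>\<^bsub>A\<^esub> (x \<otimes>\<^bsub>A\<^esub> y)"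
    and smult_mult_right:
      "\<lbrakk>a \<in> carrier R; x \<in> carrier A; y \<in> carrier A\<rbrakk> \<Longrightarrow>
        x \<otimes>\<^bsub>A\<^esub> (a \<odot>\<^bsub>A\<^esub> y) = a \<odot>\<^bsub>A\<^esub> (x \<otimes>\<^bsub>A\<^esub> y)"

definition regular_module :: "('r, 'k) ring_scheme \<Rightarrow> ('r, 'r) module" where
  "regular_module R = \<lparr>carrier = carrier R, mult = mult R, one = one R,
     zero = zero R, add = add R, smult = mult R\<rparr>"

definition linear_map ::
  "('r, 'k) ring_scheme \<Rightarrow> ('r, 'a, 'm) module_scheme \<Rightarrow> ('r, 'b, 'n) module_scheme
    \<Rightarrow> ('a \<Rightarrow> 'b) \<Rightarrow> bool" where
  "linear_map R M N f \<longleftrightarrow>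
     f \<in> carrier M \<rightarrow> carrier N \<and>
     (\<forall>x\<in>carrier M. \<forall>y\<in>carrier M. f (x \<oplus>\<^bsub>M\<^esub> y) = f x \<oplus>\<^bsub>N\<^esub> f y) \<and>
     (\<forall>a\<in>carrier R. \<forall>x\<in>carrier M. f (a \<odot>\<^bsub>M\<^esub> x) = a \<odot>\<^bsub>N\<^esub> f x)"

definition submodule_span ::
  "('r, 'k) ring_scheme \<Rightarrow> ('r, 'a, 'm) module_scheme \<Rightarrow> 'a set \<Rightarrow> 'a set" where
  "submodule_span R M S = \<Inter>{N. submodule N R M \<and> S \<subseteq> N}"

definition direct_summand ::
  "('r, 'k) ring_scheme \<Rightarrow> ('r, 'a, 'm) module_scheme \<Rightarrow> 'a set \<Rightarrow> bool" where
  "direct_summand R M S \<longleftrightarrow> submodule S R M \<and>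
     (\<exists>N. submodule N R M \<and> S \<inter> N = {\<zero>\<^bsub>M\<^esub>} \<and> S <+>\<^bsub>M\<^esub> N = carrier M)"

text \<open>
  The quotient by a submodule or a two-sided ideal: the library's quotient ring together with
  the induced scalar multiplication. If \<open>I\<close> is only a submodule, the
  multiplicative part of the record is meaningless.
\<close>

definition quotient_algebra ::
  "('r, 'a, 'm) module_scheme \<Rightarrow> 'a set \<Rightarrow> ('r, 'a set) module" where
  "quotient_algebra A I = ring.extend (A Quot I)
     (module.fields (\<lambda>a X. \<Union>x\<in>X. I +>\<^bsub>A\<^esub> (a \<odot>\<^bsub>A\<^esub> x)))"


section \<open>Tensor products\<close>

text \<open>
  \<open>M \<otimes>\<^sub>R N\<close> is the free module on \<open>M \<times> N\<close> (finitely supported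
  functions) modulo the bilinearity relations. Giving the free module the multiplication of the
  monoid ring of \<open>M \<times> N\<close> makes the quotient carry the usual product
  \<open>(x \<otimes> y)(x' \<otimes> y') = xx' \<otimes> yy'\<close> whenever \<open>M\<close> and \<open>N\<close> are
  algebras. For mere modules only the module part of the record is meaningful.
\<close>

definition single :: "('r, 'k) ring_scheme \<Rightarrow> 'x \<Rightarrow> 'x \<Rightarrow> 'r" where
  "single R p = (\<lambda>q. if q = p then \<one>\<^bsub>R\<^esub> else \<zero>\<^bsub>R\<^esub>)"

definition free_on_pairs ::
  "('r, 'k) ring_scheme \<Rightarrow> ('r, 'a, 'm) module_scheme \<Rightarrow> ('r, 'b, 'n) module_scheme
    \<Rightarrow> ('r, 'a \<times> 'b \<Rightarrow> 'r) module" where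
  "free_on_pairs R M N =
    \<lparr>carrier = {f. (\<forall>p. f p \<in> carrier R) \<and> finite {p. f p \<noteq> \<zero>\<^bsub>R\<^esub>} \<and>
                   {p. f p \<noteq> \<zero>\<^bsub>R\<^esub>} \<subseteq> carrier M \<times> carrier N},
     mult = (\<lambda>f g p. \<Oplus>\<^bsub>R\<^esub>s\<in>{(q, r). f q \<noteq> \<zero>\<^bsub>R\<^esub> \<and> g r \<noteq> \<zero>\<^bsub>R\<^esub> \<and>
               (fst q \<otimes>\<^bsub>M\<^esub> fst r, snd q \<otimes>\<^bsub>N\<^esub> snd r) = p}. f (fst s) \<otimes>\<^bsub>R\<^esub> g (snd s)),
     one = single R (\<one>\<^bsub>M\<^esub>, \<one>\<^bsub>N\<^esub>),
     zero = (\<lambda>_. \<zero>\<^bsub>R\<^esub>),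
     add = (\<lambda>f g p. f p \<oplus>\<^bsub>R\<^esub> g p),
     smult = (\<lambda>a f p. a \<otimes>\<^bsub>R\<^esub> f p)\<rparr>"

definition bilinearity_relations ::
  "('r, 'k) ring_scheme \<Rightarrow> ('r, 'a, 'm) module_scheme \<Rightarrow> ('r, 'b, 'n) module_scheme
    \<Rightarrow> ('a \<times> 'b \<Rightarrow> 'r) set" where
  "bilinearity_relations R M N = (let F = free_on_pairs R M N in
     {single R (x \<oplus>\<^bsub>M\<^esub> x', y) \<ominus>\<^bsub>F\<^esub> (single R (x, y) \<oplus>\<^bsub>F\<^esub> single R (x', y)) | x x' y.
        x \<in> carrier M \<and> x' \<in> carrier M \<and> y \<in> carrier N} \<union>
     {single R (x, y \<oplus>\<^bsub>N\<^esub> y') \<ominus>\<^bsub>F\<^esub> (single R (x, y) \<oplus>\<^bsub>F\<^esub> single R (x, y')) | x y y'.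
        x \<in> carrier M \<and> y \<in> carrier N \<and> y' \<in> carrier N} \<union>
     {single R (a \<odot>\<^bsub>M\<^esub> x, y) \<ominus>\<^bsub>F\<^esub> a \<odot>\<^bsub>F\<^esub> single R (x, y) | a x y.
        a \<in> carrier R \<and> x \<in> carrier M \<and> y \<in> carrier N} \<union>
     {single R (x, a \<odot>\<^bsub>N\<^esub> y) \<ominus>\<^bsub>F\<^esub> a \<odot>\<^bsub>F\<^esub> single R (x, y) | a x y.
        a \<in> carrier R \<and> x \<in> carrier M \<and> y \<in> carrier N})"

definition tensor_kernel ::
  "('r, 'k) ring_scheme \<Rightarrow> ('r, 'a, 'm) module_scheme \<Rightarrow> ('r, 'b, 'n) module_scheme
    \<Rightarrow> ('a \<times> 'b \<Rightarrow> 'r) set" where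
  "tensor_kernel R M N =
     submodule_span R (free_on_pairs R M N) (bilinearity_relations R M N)"

definition tensor ::
  "('r, 'k) ring_scheme \<Rightarrow> ('r, 'a, 'm) module_scheme \<Rightarrow> ('r, 'b, 'n) module_scheme
    \<Rightarrow> ('r, ('a \<times> 'b \<Rightarrow> 'r) set) module" where
  "tensor R M N = quotient_algebra (free_on_pairs R M N) (tensor_kernel R M N)"

definition pure ::
  "('r, 'k) ring_scheme \<Rightarrow> ('r, 'a, 'm) module_scheme \<Rightarrow> ('r, 'b, 'n) module_scheme
    \<Rightarrow> 'a \<Rightarrow> 'b \<Rightarrow> ('a \<times> 'b \<Rightarrow> 'r) set" where
  "pure R M N x y = tensor_kernel R M N +>\<^bsub>free_on_pairs R M N\<^esub> single R (x, y)"

text \<open>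
  The linear map \<open>M \<otimes>\<^sub>R N \<rightarrow> P\<close> induced by a bilinear map \<open>\<beta>\<close>: the linear extension of
  \<open>\<beta>\<close> to formal sums is constant on each coset, and \<^const>\<open>the_elem\<close> extracts that value.
\<close>

definition tensor_lift ::
  "('r, 'k) ring_scheme \<Rightarrow> ('r, 'p, 'm) module_scheme
    \<Rightarrow> ('a \<Rightarrow> 'b \<Rightarrow> 'p) \<Rightarrow> ('a \<times> 'b \<Rightarrow> 'r) set \<Rightarrow> 'p" where
  "tensor_lift R P \<beta> X =
     the_elem ((\<lambda>f. \<Oplus>\<^bsub>P\<^esub>p\<in>{p. f p \<noteq> \<zero>\<^bsub>R\<^esub>}. f p \<odot>\<^bsub>P\<^esub> \<beta> (fst p) (snd p)) ` X)"

definition tensor_map ::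
  "('r, 'k) ring_scheme \<Rightarrow> ('r, 'c, 'm) module_scheme \<Rightarrow> ('r, 'd, 'n) module_scheme
    \<Rightarrow> ('a \<Rightarrow> 'c) \<Rightarrow> ('b \<Rightarrow> 'd) \<Rightarrow> ('a \<times> 'b \<Rightarrow> 'r) set \<Rightarrow> ('c \<times> 'd \<Rightarrow> 'r) set" where
  "tensor_map R M' N' f g =
     tensor_lift R (tensor R M' N') (\<lambda>x y. pure R M' N' (f x) (g y))"

text \<open>The canonical map \<open>(L \<otimes> M) \<otimes> N \<rightarrow> L \<otimes> (M \<otimes> N)\<close>.\<close>

definition tensor_assoc ::
  "('r, 'k) ring_scheme \<Rightarrow> ('r, 'a, 'l) module_scheme \<Rightarrow> ('r, 'b, 'm) module_scheme
    \<Rightarrow> ('r, 'c, 'n) module_scheme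
    \<Rightarrow> (('a \<times> 'b \<Rightarrow> 'r) set \<times> 'c \<Rightarrow> 'r) set
    \<Rightarrow> ('a \<times> ('b \<times> 'c \<Rightarrow> 'r) set \<Rightarrow> 'r) set" where
  "tensor_assoc R L M N =
     tensor_lift R (tensor R L (tensor R M N)) (\<lambda>t z.
       tensor_lift R (tensor R L (tensor R M N)) (\<lambda>x y.
         pure R L (tensor R M N) x (pure R M N y z)) t)"


section \<open>Coalgebras, bialgebras, Hopf algebras and Hopf coactions\<close>

locale coalgebra = module R C for R (structure) and C (structure) +
  fixes \<Delta> and \<epsilon>
  assumes comult_linear: "linear_map R C (tensor R C C) \<Delta>"
    and counit_linear: "linear_map R C (regular_module R) \<epsilon>"
    and coassoc: "x \<in> carrier C \<Longrightarrow>
        tensor_assoc R C C C (tensor_map R (tensor R C C) C \<Delta> (\<lambda>y. y) (\<Delta> x)) =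
        tensor_map R C (tensor R C C) (\<lambda>y. y) \<Delta> (\<Delta> x)"
    and counit_left: "x \<in> carrier C \<Longrightarrow> tensor_lift R C (\<lambda>y z. \<epsilon> y \<odot>\<^bsub>C\<^esub> z) (\<Delta> x) = x"
    and counit_right: "x \<in> carrier C \<Longrightarrow> tensor_lift R C (\<lambda>y z. \<epsilon> z \<odot>\<^bsub>C\<^esub> y) (\<Delta> x) = x"

locale bialgebra = assoc_algebra R B + coalgebra R B \<Delta> \<epsilon>
  for R (structure) and B (structure) and \<Delta> and \<epsilon> +
  assumes comult_hom: "\<Delta> \<in> ring_hom B (tensor R B B)"
    and counit_hom: "\<epsilon> \<in> ring_hom B R"

locale hopf_algebra = bialgebra R H \<Delta> \<epsilon>
  for R (structure) and H (structure) and \<Delta> and \<epsilon> +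
  assumes antipode: "\<exists>S. linear_map R H H S \<and>
    (\<forall>x\<in>carrier H.
       tensor_lift R H (\<lambda>y z. S y \<otimes>\<^bsub>H\<^esub> z) (\<Delta> x) = \<epsilon> x \<odot>\<^bsub>H\<^esub> \<one>\<^bsub>H\<^esub> \<and>
       tensor_lift R H (\<lambda>y z. y \<otimes>\<^bsub>H\<^esub> S z) (\<Delta> x) = \<epsilon> x \<odot>\<^bsub>H\<^esub> \<one>\<^bsub>H\<^esub>)"

text \<open>
  A right coaction of a Hopf algebra \<open>H\<close> on an algebra \<open>A\<close>: a coassociative and counital
  linear map \<open>A \<rightarrow> A \<otimes> H\<close> which is a homomorphism of algebras.
\<close>

locale hopf_coaction = H: hopf_algebra R H \<Delta> \<epsilon> + A: assoc_algebra R A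
  for R (structure) and H (structure) and \<Delta> and \<epsilon> and A (structure) +
  fixes \<rho>
  assumes coaction_linear: "linear_map R A (tensor R A H) \<rho>"
    and coaction_coassoc: "x \<in> carrier A \<Longrightarrow>
        tensor_assoc R A H H (tensor_map R (tensor R A H) H \<rho> (\<lambda>h. h) (\<rho> x)) =
        tensor_map R A (tensor R H H) (\<lambda>y. y) \<Delta> (\<rho> x)"
    and coaction_counit: "x \<in> carrier A \<Longrightarrow>
        tensor_lift R A (\<lambda>y h. \<epsilon> h \<odot>\<^bsub>A\<^esub> y) (\<rho> x) = x"
    and coaction_hom: "\<rho> \<in> ring_hom A (tensor R A H)"


section \<open>Semigrouplike elements and the quasi-filtrations\<close>

definition semigrouplikes where
  "semigrouplikes R C \<Delta> = {g \<in> carrier C. g \<noteq> \<zero>\<^bsub>C\<^esub> \<and> \<Delta> g = pure R C C g g}"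

definition grouplikes where
  "grouplikes R C \<Delta> \<epsilon> = {g \<in> semigrouplikes R C \<Delta>. \<epsilon> g = \<one>\<^bsub>R\<^esub>}"

definition box_tensor ::
  "('r, 'k) ring_scheme \<Rightarrow> ('r, 'a, 'm) module_scheme \<Rightarrow> 'a set \<Rightarrow> 'a set
    \<Rightarrow> ('a \<times> 'a \<Rightarrow> 'r) set set" where
  "box_tensor R C M N =
     {\<Oplus>\<^bsub>tensor R C C\<^esub>i\<in>{..<n::nat}. pure R C C (x i) (y i) | n x y.
        \<forall>i<n. x i \<in> M \<and> y i \<in> N}"

text \<open>The sum of a family of submodules is rendered as the span of their union.\<close>

primrec quasi_filtration ::
  "('r, 'k) ring_scheme \<Rightarrow> ('r, 'a, 'm) module_scheme \<Rightarrow> ('a \<Rightarrow> ('a \<times> 'a \<Rightarrow> 'r) set)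
    \<Rightarrow> nat \<Rightarrow> 'a \<Rightarrow> 'a \<Rightarrow> 'a set" where
  "quasi_filtration R C \<Delta> 0 = (\<lambda>g h.
     {a \<odot>\<^bsub>C\<^esub> g | a. a \<in> carrier R} \<inter> {a \<odot>\<^bsub>C\<^esub> h | a. a \<in> carrier R})"
| "quasi_filtration R C \<Delta> (Suc n) = (\<lambda>g h.
     {x \<in> carrier C.
        \<Delta> x \<ominus>\<^bsub>tensor R C C\<^esub> pure R C C g x \<ominus>\<^bsub>tensor R C C\<^esub> pure R C C x h
        \<in> submodule_span R (tensor R C C)
            (\<Union>t\<in>semigrouplikes R C \<Delta>.
               box_tensor R C (quasi_filtration R C \<Delta> n g t) (quasi_filtration R C \<Delta> n t h))})"

definition total_quasi_filtration ::
  "('r, 'k) ring_scheme \<Rightarrow> ('r, 'a, 'm) module_scheme \<Rightarrow> ('a \<Rightarrow> ('a \<times> 'a \<Rightarrow> 'r) set)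
    \<Rightarrow> nat \<Rightarrow> 'a set" where
  "total_quasi_filtration R C \<Delta> n = submodule_span R C
     (\<Union>g\<in>semigrouplikes R C \<Delta>. \<Union>h\<in>semigrouplikes R C \<Delta>. quasi_filtration R C \<Delta> n g h)"

definition sg_flavored where
  "sg_flavored R C \<Delta> \<longleftrightarrow> carrier C = (\<Union>n. total_quasi_filtration R C \<Delta> n)"

definition split_sg_flavored where
  "split_sg_flavored R C \<Delta> \<longleftrightarrow>
     sg_flavored R C \<Delta> \<and> direct_summand R C (total_quasi_filtration R C \<Delta> 0)"


section \<open>The reduced Hopf algebra and the Brown map\<close>

definition reduction_ideal where
  "reduction_ideal R B \<Delta> \<epsilon> =
     Idl\<^bsub>B\<^esub> {g \<ominus>\<^bsub>B\<^esub> h | g h. g \<in> grouplikes R B \<Delta> \<epsilon> \<and> h \<in> grouplikes R B \<Delta> \<epsilon>}"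

definition reduced_algebra where
  "reduced_algebra R B \<Delta> \<epsilon> = quotient_algebra B (reduction_ideal R B \<Delta> \<epsilon>)"

definition reduction where
  "reduction R B \<Delta> \<epsilon> x = reduction_ideal R B \<Delta> \<epsilon> +>\<^bsub>B\<^esub> x"

text \<open>
  The coalgebra structure \<open>\<Delta>', \<epsilon>'\<close> induced on the quotient, i.e. the one for which the projection
  \<open>\<pi>\<close> satisfies \<open>\<Delta>' \<circ> \<pi> = (\<pi> \<otimes> \<pi>) \<circ> \<Delta>\<close> and \<open>\<epsilon>' \<circ> \<pi> = \<epsilon>\<close>.
\<close>

definition reduced_comult where
  "reduced_comult R B \<Delta> \<epsilon> X =
     the_elem ((\<lambda>x. tensor_map R (reduced_algebra R B \<Delta> \<epsilon>) (reduced_algebra R B \<Delta> \<epsilon>)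
                      (reduction R B \<Delta> \<epsilon>) (reduction R B \<Delta> \<epsilon>) (\<Delta> x)) ` X)"

definition reduced_counit where
  "reduced_counit R B \<Delta> \<epsilon> X = the_elem (\<epsilon> ` X)"

definition brown_map where
  "brown_map R B \<Delta> \<epsilon> x =
     tensor_map R B (reduced_algebra R B \<Delta> \<epsilon>) (\<lambda>y. y) (reduction R B \<Delta> \<epsilon>) (\<Delta> x)"

end

theory Submission
  imports Defs
begin

text \<open>
  The algebra homomorphisms \<open>(\<pi> \<otimes> \<pi>) \<circ> \<Delta>\<close> and \<open>\<epsilon>\<close> are each constant on the grouplikes, so
  they vanish on the ideal \<open>I\<close> and descend to a bialgebra structure on \<open>H = B/I\<close>; the coaction
  axioms for \<open>(id \<otimes> \<pi>) \<circ> \<Delta>\<close> then come from those of the coalgebra \<open>B\<close> by naturality.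
  The antipode is found by Takeuchi's argument. Put \<open>u = \<eta>\<epsilon>\<close> and \<open>P = u - id\<close> on \<open>H\<close>.
  As \<open>\<pi> g = 1\<close> for grouplike \<open>g\<close>, \<open>P\<close> kills \<open>\<pi> g\<close>, and if
  \<open>\<Delta> x = g \<otimes> x + x \<otimes> h + \<Sum> y \<otimes> z\<close> with \<open>z\<close> in the \<open>n\<close>-th stage of the quasi-filtration, then
  \<open>P\<^sup>m\<^sup>+\<^sup>1(\<pi> x) = P(\<pi> g) P\<^sup>m(\<pi> x) + P(\<pi> x) P\<^sup>m(\<pi> h) + \<Sum> P(\<pi> y) P\<^sup>m(\<pi> z)\<close>, where
  powers are taken for convolution. By induction \<open>P\<^sup>m\<close> vanishes on the image of the \<open>n\<close>-th
  stage for \<open>m > n\<close>, so the geometric series \<open>\<Sum> P\<^sup>m\<close> is pointwise finite and inverts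
  \<open>id = u - P\<close>.
\<close>

section \<open>Linear maps and quotient modules\<close>

text \<open>A tensor is a coset of formal sums and maps out of a tensor product are defined through
  \<open>the_elem\<close>, so nothing can be computed before well-definedness is known. Later
  equations between such maps rest on two facts: the value of a lift on pure tensors
  (\<open>tensor_lift_pure\<close>) and the equality of linear maps that agree on pure tensors
  (\<open>tensor_ext\<close>). Arguments with Sweedler notation become inductions over pure tensors
  and sums.

  That \<open>P\<close> kills the images of grouplikes needs \<open>\<pi> g = 1\<close>, not merely
  that all \<open>\<pi> g\<close> coincide; it holds because the unit of a nonzero bialgebra is
  itself semigrouplike. Powers of \<open>P\<close> at \<open>\<pi> x\<close> are evaluated through
  the coproduct of \<open>B\<close>, so no filtration of \<open>B/I\<close> has to be introduced.

  Pointwise finiteness leaves one difficulty: the length of the series at \<open>x\<close> says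
  nothing about its length at the factors of \<open>\<Delta> x\<close>. A tensor is a finite sum, so
  one truncation serves all its factors, and the identities for truncated series, with error term
  \<open>P^k\<close>, can be read off at that truncation.\<close>

lemma linear_mapI:
  assumes "\<And>x. x \<in> carrier M \<Longrightarrow> f x \<in> carrier N"
    and "\<And>x y. \<lbrakk>x \<in> carrier M; y \<in> carrier M\<rbrakk> \<Longrightarrow> f (x \<oplus>\<^bsub>M\<^esub> y) = f x \<oplus>\<^bsub>N\<^esub> f y"
    and "\<And>a x. \<lbrakk>a \<in> carrier R; x \<in> carrier M\<rbrakk> \<Longrightarrow> f (a \<odot>\<^bsub>M\<^esub> x) = a \<odot>\<^bsub>N\<^esub> f x"
  shows "linear_map R M N f"
  using assms by (auto simp: linear_map_def)

lemma linear_map_closed: "\<lbrakk>linear_map R M N f; x \<in> carrier M\<rbrakk> \<Longrightarrow> f x \<in> carrier N"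
  and linear_map_add:
    "\<lbrakk>linear_map R M N f; x \<in> carrier M; y \<in> carrier M\<rbrakk> \<Longrightarrow> f (x \<oplus>\<^bsub>M\<^esub> y) = f x \<oplus>\<^bsub>N\<^esub> f y"
  and linear_map_smult:
    "\<lbrakk>linear_map R M N f; a \<in> carrier R; x \<in> carrier M\<rbrakk> \<Longrightarrow> f (a \<odot>\<^bsub>M\<^esub> x) = a \<odot>\<^bsub>N\<^esub> f x"
  by (auto simp: linear_map_def)

text \<open>Maps are compared on carriers only, their values elsewhere being arbitrary; the module
  structure of \<open>M\<close> keeps sums and multiples inside the carrier, so that the comparison
  applies to them.\<close>

lemma linear_map_eq:
  assumes "linear_map R M N g" and "\<And>x. x \<in> carrier M \<Longrightarrow> f x = g x" and "module R M"
  shows "linear_map R M N f"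
proof -
  interpret module R M by fact
  show ?thesis using assms(1,2) by (auto simp: linear_map_def Pi_def)
qed

lemma linear_map_id: "linear_map R M M (\<lambda>x. x)"
  by (auto simp: linear_map_def)

lemma linear_map_comp:
  "\<lbrakk>linear_map R M N f; linear_map R N P g\<rbrakk> \<Longrightarrow> linear_map R M P (\<lambda>x. g (f x))"
  by (auto simp: linear_map_def Pi_def)

lemma linear_map_zero:
  assumes "module R M" "module R N" "linear_map R M N f"
  shows "f \<zero>\<^bsub>M\<^esub> = \<zero>\<^bsub>N\<^esub>"
proof -
  interpret M: module R M by fact
  interpret N: module R N by fact
  show ?thesis
    using linear_map_smult[OF assms(3), of "\<zero>\<^bsub>R\<^esub>" "\<zero>\<^bsub>M\<^esub>"] linear_map_closed[OF assms(3), of "\<zero>\<^bsub>M\<^esub>"]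
    by simp
qed

lemma (in module) smult_minus_one: "x \<in> carrier M \<Longrightarrow> (\<ominus> \<one>) \<odot>\<^bsub>M\<^esub> x = \<ominus>\<^bsub>M\<^esub> x"
  using smult_l_minus[of \<one> x] by simp

lemma linear_map_minus:
  assumes "module R M" "module R N" "linear_map R M N f" "x \<in> carrier M"
  shows "f (\<ominus>\<^bsub>M\<^esub> x) = \<ominus>\<^bsub>N\<^esub> f x"
proof -
  interpret M: module R M by fact
  interpret N: module R N by fact
  have "f (\<ominus>\<^bsub>M\<^esub> x) = f ((\<ominus>\<^bsub>R\<^esub> \<one>\<^bsub>R\<^esub>) \<odot>\<^bsub>M\<^esub> x)"
    using assms(4) by (simp add: M.smult_minus_one)
  also have "\<dots> = (\<ominus>\<^bsub>R\<^esub> \<one>\<^bsub>R\<^esub>) \<odot>\<^bsub>N\<^esub> f x"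
    using assms(4) by (intro linear_map_smult[OF assms(3)]) auto
  finally show ?thesis
    using linear_map_closed[OF assms(3,4)] by (simp add: N.smult_minus_one)
qed

lemma linear_map_diff:
  assumes "module R M" "module R N" "linear_map R M N f" "x \<in> carrier M" "y \<in> carrier M"
  shows "f (x \<ominus>\<^bsub>M\<^esub> y) = f x \<ominus>\<^bsub>N\<^esub> f y"
proof -
  interpret M: module R M by fact
  show ?thesis
    using assms by (simp add: a_minus_def linear_map_add[OF assms(3)] linear_map_minus[OF assms(1-3)])
qed

lemma linear_map_const_zero:
  assumes "module R N"
  shows "linear_map R M N (\<lambda>_. \<zero>\<^bsub>N\<^esub>)"
proof -
  interpret N: module R N by fact
  show ?thesis by (rule linear_mapI) auto
qed

lemma linear_map_plus:
  assumes "module R N" "linear_map R M N f" "linear_map R M N g"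
  shows "linear_map R M N (\<lambda>x. f x \<oplus>\<^bsub>N\<^esub> g x)"
proof -
  interpret N: module R N by fact
  show ?thesis
    by (rule linear_mapI)
      (auto simp: linear_map_add[OF assms(2)] linear_map_add[OF assms(3)] linear_map_smult[OF assms(2)]
        linear_map_smult[OF assms(3)] linear_map_closed[OF assms(2)] linear_map_closed[OF assms(3)]
        N.smult_r_distr N.a_ac)
qed

lemma linear_map_smult_fun:
  assumes "module R N" "linear_map R M N f" "a \<in> carrier R"
  shows "linear_map R M N (\<lambda>x. a \<odot>\<^bsub>N\<^esub> f x)"
proof -
  interpret N: module R N by fact
  have "a \<odot>\<^bsub>N\<^esub> (b \<odot>\<^bsub>N\<^esub> y) = b \<odot>\<^bsub>N\<^esub> (a \<odot>\<^bsub>N\<^esub> y)" if "b \<in> carrier R" "y \<in> carrier N" for b y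
    using that assms(3) N.smult_assoc1 N.R.m_comm by metis
  then show ?thesis
    using assms(3)
    by (intro linear_mapI)
      (auto simp: linear_map_add[OF assms(2)] linear_map_smult[OF assms(2)] linear_map_closed[OF assms(2)]
        N.smult_r_distr)
qed

lemma linear_map_finsum:
  assumes "module R M" "module R N" "linear_map R M N f" "finite A" "\<And>i. i \<in> A \<Longrightarrow> h i \<in> carrier M"
  shows "f (\<Oplus>\<^bsub>M\<^esub>i\<in>A. h i) = (\<Oplus>\<^bsub>N\<^esub>i\<in>A. f (h i))"
proof -
  interpret M: module R M by fact
  interpret N: module R N by fact
  show ?thesis using assms(4,5)
  proof (induction A rule: finite_induct)
    case empty
    then show ?case by (simp add: linear_map_zero[OF assms(1-3)])
  next
    case (insert x F)
    then have "h \<in> F \<rightarrow> carrier M" by auto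
    with insert show ?case
      by (simp add: linear_map_add[OF assms(3)] linear_map_closed[OF assms(3)] Pi_def)
  qed
qed

lemma linear_map_finsum_fun:
  assumes "module R N" "finite A" "\<And>i. i \<in> A \<Longrightarrow> linear_map R M N (f i)" "module R M"
  shows "linear_map R M N (\<lambda>x. \<Oplus>\<^bsub>N\<^esub>i\<in>A. f i x)"
proof -
  interpret N: module R N by fact
  show ?thesis using assms(2,3)
  proof (induction A rule: finite_induct)
    case empty
    then show ?case by (simp add: linear_map_const_zero[OF assms(1)])
  next
    case (insert i F)
    then have "linear_map R M N (\<lambda>x. f i x \<oplus>\<^bsub>N\<^esub> (\<Oplus>\<^bsub>N\<^esub>i\<in>F. f i x))"
      by (intro linear_map_plus[OF assms(1)]) auto
    moreover have "(\<Oplus>\<^bsub>N\<^esub>i\<in>insert i F. f i x) = f i x \<oplus>\<^bsub>N\<^esub> (\<Oplus>\<^bsub>N\<^esub>i\<in>F. f i x)" if "x \<in> carrier M" for x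
      using insert that linear_map_closed by (subst N.finsum_insert) (fastforce simp: Pi_def)+
    ultimately show ?case
      by (rule linear_map_eq[OF _ _ assms(4)])
  qed
qed

text \<open>With \<open>submodule_span_least\<close> this reduces vanishing of a linear map on a
  span to vanishing on generators; the bilinearity relations and the stages of the quasi-filtration
  are both treated in this way.\<close>

lemma linear_map_ker_submodule:
  assumes "module R M" "module R N" "linear_map R M N f"
  shows "submodule {x \<in> carrier M. f x = \<zero>\<^bsub>N\<^esub>} R M"
proof -
  interpret M: module R M by fact
  interpret N: module R N by fact
  show ?thesis
    by (rule M.submoduleI)
      (auto simp: linear_map_zero[OF assms] linear_map_minus[OF assms] linear_map_add[OF assms(3)]
        linear_map_smult[OF assms(3)])
qed

section \<open>Spans\<close>

lemma submodule_span_least: "\<lbrakk>submodule N R M; S \<subseteq> N\<rbrakk> \<Longrightarrow> submodule_span R M S \<subseteq> N"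
  by (auto simp: submodule_span_def)

lemma submodule_span_superset: "S \<subseteq> submodule_span R M S"
  by (auto simp: submodule_span_def)

lemma submodule_span_submodule:
  assumes "module R M" "S \<subseteq> carrier M"
  shows "submodule (submodule_span R M S) R M"
proof -
  interpret module R M by fact
  note E = submoduleE
  show ?thesis
  proof (rule submoduleI)
    show "submodule_span R M S \<subseteq> carrier M"
      using carrier_is_submodule assms(2) by (auto simp: submodule_span_def)
    show "\<zero>\<^bsub>M\<^esub> \<in> submodule_span R M S"
      using subgroup.one_closed submodule.axioms(1) by (fastforce simp: submodule_span_def)
  qed (auto simp: submodule_span_def E)
qed

section \<open>Quotients of modules by submodules\<close>

lemma ring_extend_module_simps [simp]:
  "carrier (ring.extend A (module.fields s)) = carrier A"
  "mult (ring.extend A (module.fields s)) = mult A"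
  "one (ring.extend A (module.fields s)) = one A"
  "zero (ring.extend A (module.fields s)) = zero A"
  "add (ring.extend A (module.fields s)) = add A"
  "smult (ring.extend A (module.fields s)) = s"
  by (simp_all add: ring.defs module.defs monoid.defs partial_object.defs)

context module
begin

context
  fixes S
  assumes S: "submodule S R M"
begin

lemma submodule_abelian_subgroup: "abelian_subgroup S M"
  using submodule.axioms(1)[OF S] abelian_group_axioms
  by (intro abelian_subgroupI3 additive_subgroup.intro)

interpretation S: abelian_subgroup S M by (rule submodule_abelian_subgroup)

lemma quotient_carrier: "carrier (quotient_algebra M S) = (\<lambda>x. S +>\<^bsub>M\<^esub> x) ` carrier M"
  by (auto simp: quotient_algebra_def FactRing_def A_RCOSETS_def')

lemma quotient_coset_closed: "x \<in> carrier M \<Longrightarrow> S +>\<^bsub>M\<^esub> x \<in> carrier (quotient_algebra M S)"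
  by (simp add: quotient_carrier)

lemma quotient_add:
  "\<lbrakk>x \<in> carrier M; y \<in> carrier M\<rbrakk> \<Longrightarrow>
     (S +>\<^bsub>M\<^esub> x) \<oplus>\<^bsub>quotient_algebra M S\<^esub> (S +>\<^bsub>M\<^esub> y) = S +>\<^bsub>M\<^esub> (x \<oplus>\<^bsub>M\<^esub> y)"
  by (simp add: quotient_algebra_def FactRing_def S.a_rcos_sum)

lemma quotient_zero: "\<zero>\<^bsub>quotient_algebra M S\<^esub> = S +>\<^bsub>M\<^esub> \<zero>\<^bsub>M\<^esub>"
  by (simp add: quotient_algebra_def FactRing_def S.a_subset)

lemma coset_eq_iff:
  assumes "x \<in> carrier M" "y \<in> carrier M"
  shows "S +>\<^bsub>M\<^esub> x = S +>\<^bsub>M\<^esub> y \<longleftrightarrow> x \<ominus>\<^bsub>M\<^esub> y \<in> S"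
proof -
  have "S +>\<^bsub>M\<^esub> x = S +>\<^bsub>M\<^esub> y \<longleftrightarrow> x \<in> S +>\<^bsub>M\<^esub> y"
    using assms S.a_repr_independence' S.a_rcos_self by metis
  then show ?thesis
    using S.a_rcos_module[OF assms(2,1)] by (simp add: a_minus_def)
qed

text \<open>The scalar multiple of a coset is defined as a union over its representatives. It
  collapses to a single coset since \<open>a(y - x)\<close> lies in \<open>S\<close> whenever
  \<open>y - x\<close> does.\<close>

lemma quotient_smult:
  assumes a: "a \<in> carrier R" and x: "x \<in> carrier M"
  shows "a \<odot>\<^bsub>quotient_algebra M S\<^esub> (S +>\<^bsub>M\<^esub> x) = S +>\<^bsub>M\<^esub> (a \<odot>\<^bsub>M\<^esub> x)"
proof -
  have "S +>\<^bsub>M\<^esub> (a \<odot>\<^bsub>M\<^esub> y) = S +>\<^bsub>M\<^esub> (a \<odot>\<^bsub>M\<^esub> x)" if "y \<in> S +>\<^bsub>M\<^esub> x" for y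
  proof -
    have y: "y \<in> carrier M" using that x S.a_elemrcos_carrier by blast
    have "y \<ominus>\<^bsub>M\<^esub> x \<in> S"
      using that x y S.a_repr_independence' coset_eq_iff by metis
    then have "a \<odot>\<^bsub>M\<^esub> (y \<ominus>\<^bsub>M\<^esub> x) \<in> S"
      using submoduleE(4)[OF S] a by blast
    then have "a \<odot>\<^bsub>M\<^esub> y \<ominus>\<^bsub>M\<^esub> a \<odot>\<^bsub>M\<^esub> x \<in> S"
      using a x y by (simp add: a_minus_def smult_r_distr smult_r_minus)
    then show ?thesis using a x y by (simp add: coset_eq_iff)
  qed
  then have "(\<Union>y\<in>S +>\<^bsub>M\<^esub> x. S +>\<^bsub>M\<^esub> (a \<odot>\<^bsub>M\<^esub> y)) = S +>\<^bsub>M\<^esub> (a \<odot>\<^bsub>M\<^esub> x)"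
    using S.a_rcos_self[OF x] by blast
  then show ?thesis by (simp add: quotient_algebra_def)
qed

lemma quotient_module: "module R (quotient_algebra M S)"
proof (rule moduleI)
  let ?Q = "quotient_algebra M S"
  note simps = quotient_add quotient_smult quotient_zero
  show "cring R" ..
  show "abelian_group ?Q"
  proof (rule abelian_groupI)
    fix X assume "X \<in> carrier ?Q"
    then obtain x where x: "x \<in> carrier M" "X = S +>\<^bsub>M\<^esub> x" by (auto simp: quotient_carrier)
    then have "(S +>\<^bsub>M\<^esub> (\<ominus>\<^bsub>M\<^esub> x)) \<oplus>\<^bsub>?Q\<^esub> X = \<zero>\<^bsub>?Q\<^esub>"
      by (simp add: simps M.l_neg)
    then show "\<exists>Y\<in>carrier ?Q. Y \<oplus>\<^bsub>?Q\<^esub> X = \<zero>\<^bsub>?Q\<^esub>"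
      using x quotient_coset_closed by (metis M.a_inv_closed)
  qed (auto simp: quotient_carrier simps M.a_ac)
qed (auto simp: quotient_carrier quotient_add quotient_smult smult_l_distr smult_r_distr smult_assoc1)

lemma quotient_proj_linear: "linear_map R M (quotient_algebra M S) (\<lambda>x. S +>\<^bsub>M\<^esub> x)"
  by (rule linear_mapI) (auto simp: quotient_carrier quotient_add quotient_smult)

end

end

text \<open>A linear map that kills \<open>S\<close> is constant on cosets, so the image of a coset
  is a singleton and \<open>the_elem\<close> is meaningful. This is the well-definedness behind
  \<open>tensor_lift\<close>, \<open>reduced_comult\<close> and
  \<open>reduced_counit\<close>.\<close>

lemma (in module) linear_map_the_elem_coset:
  assumes S: "submodule S R M" and N: "module R N" and f: "linear_map R M N f"
    and zero: "\<And>s. s \<in> S \<Longrightarrow> f s = \<zero>\<^bsub>N\<^esub>" and x: "x \<in> carrier M"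
  shows "the_elem (f ` (S +>\<^bsub>M\<^esub> x)) = f x"
proof -
  interpret N: module R N by fact
  interpret S: abelian_subgroup S M by (rule submodule_abelian_subgroup[OF S])
  have "f y = f x" if y: "y \<in> S +>\<^bsub>M\<^esub> x" for y
  proof -
    obtain s where "s \<in> S" "y = s \<oplus>\<^bsub>M\<^esub> x"
      using y by (auto simp: a_r_coset_def')
    then show ?thesis
      using x S.a_subset zero by (auto simp: linear_map_add[OF f] linear_map_closed[OF f])
  qed
  then have "f ` (S +>\<^bsub>M\<^esub> x) = {f x}"
    using S.a_rcos_self[OF x] by blast
  then show ?thesis by simp
qed

section \<open>The universal property of the tensor product\<close>

lemma free_on_pairs_simps:
  "carrier (free_on_pairs R M N) =
     {f. (\<forall>p. f p \<in> carrier R) \<and> finite {p. f p \<noteq> \<zero>\<^bsub>R\<^esub>} \<and>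
         {p. f p \<noteq> \<zero>\<^bsub>R\<^esub>} \<subseteq> carrier M \<times> carrier N}"
  "zero (free_on_pairs R M N) = (\<lambda>_. \<zero>\<^bsub>R\<^esub>)"
  "add (free_on_pairs R M N) f g = (\<lambda>p. f p \<oplus>\<^bsub>R\<^esub> g p)"
  "smult (free_on_pairs R M N) a f = (\<lambda>p. a \<otimes>\<^bsub>R\<^esub> f p)"
  by (simp_all add: free_on_pairs_def)

lemma free_on_pairs_apply: "f \<in> carrier (free_on_pairs R M N) \<Longrightarrow> f p \<in> carrier R"
  and free_on_pairs_finite: "f \<in> carrier (free_on_pairs R M N) \<Longrightarrow> finite {p. f p \<noteq> \<zero>\<^bsub>R\<^esub>}"
  and free_on_pairs_support:
    "f \<in> carrier (free_on_pairs R M N) \<Longrightarrow> {p. f p \<noteq> \<zero>\<^bsub>R\<^esub>} \<subseteq> carrier M \<times> carrier N"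
  by (simp_all add: free_on_pairs_simps del: split_paired_All)

lemma free_on_pairs_module:
  assumes "cring R"
  shows "module R (free_on_pairs R M N)"
proof -
  interpret R: cring R by fact
  \<comment> \<open>Sums, negatives and scalar multiples vanish wherever their arguments do, so
    their supports lie in a union of two finite supports.\<close>
  have fin: "finite {p. h p \<noteq> \<zero>\<^bsub>R\<^esub>} \<and> {p. h p \<noteq> \<zero>\<^bsub>R\<^esub>} \<subseteq> A"
    if "finite {p. f p \<noteq> \<zero>\<^bsub>R\<^esub>}" "finite {p. g p \<noteq> \<zero>\<^bsub>R\<^esub>}" "\<And>p. f p = \<zero>\<^bsub>R\<^esub> \<Longrightarrow> g p = \<zero>\<^bsub>R\<^esub> \<Longrightarrow> h p = \<zero>\<^bsub>R\<^esub>"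
      "{p. f p \<noteq> \<zero>\<^bsub>R\<^esub>} \<subseteq> A" "{p. g p \<noteq> \<zero>\<^bsub>R\<^esub>} \<subseteq> A" for f g h :: "'c \<times> 'd \<Rightarrow> 'a" and A
    using that by (auto intro: finite_subset[of _ "{p. f p \<noteq> \<zero>\<^bsub>R\<^esub>} \<union> {p. g p \<noteq> \<zero>\<^bsub>R\<^esub>}"])
  let ?F = "free_on_pairs R M N"
  have add: "f \<oplus>\<^bsub>?F\<^esub> g \<in> carrier ?F" if "f \<in> carrier ?F" "g \<in> carrier ?F" for f g
    using that fin[of f g "\<lambda>p. f p \<oplus>\<^bsub>R\<^esub> g p" "carrier M \<times> carrier N"] by (simp add: free_on_pairs_simps)
  have neg: "(\<lambda>p. \<ominus>\<^bsub>R\<^esub> f p) \<in> carrier ?F" if "f \<in> carrier ?F" for f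
    using that fin[of f f "\<lambda>p. \<ominus>\<^bsub>R\<^esub> f p" "carrier M \<times> carrier N"] by (simp add: free_on_pairs_simps)
  have smult: "a \<odot>\<^bsub>?F\<^esub> f \<in> carrier ?F" if "f \<in> carrier ?F" "a \<in> carrier R" for f a
    using that fin[of f f "\<lambda>p. a \<otimes>\<^bsub>R\<^esub> f p" "carrier M \<times> carrier N"] by (simp add: free_on_pairs_simps)
  show ?thesis
  proof (rule moduleI)
    show "cring R" by fact
    show "abelian_group ?F"
    proof (rule abelian_groupI)
      fix f assume "f \<in> carrier ?F"
      then have "(\<lambda>p. \<ominus>\<^bsub>R\<^esub> f p) \<oplus>\<^bsub>?F\<^esub> f = \<zero>\<^bsub>?F\<^esub>" "(\<lambda>p. \<ominus>\<^bsub>R\<^esub> f p) \<in> carrier ?F"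
        using neg[of f] by (auto simp: free_on_pairs_simps(2,3) fun_eq_iff R.l_neg free_on_pairs_apply)
      then show "\<exists>g\<in>carrier ?F. g \<oplus>\<^bsub>?F\<^esub> f = \<zero>\<^bsub>?F\<^esub>" by blast
    qed (use add in \<open>auto simp: free_on_pairs_simps fun_eq_iff R.a_ac\<close>)
  qed (use smult in \<open>auto simp: free_on_pairs_simps fun_eq_iff R.l_distr R.r_distr R.m_assoc\<close>)
qed

lemma single_closed:
  assumes "cring R" "x \<in> carrier M" "y \<in> carrier N"
  shows "single R (x, y) \<in> carrier (free_on_pairs R M N)"
proof -
  interpret R: cring R by fact
  show ?thesis
    using assms(2,3) by (auto simp: free_on_pairs_simps single_def intro: finite_subset[of _ "{(x, y)}"])
qed

lemma finsum_free_on_pairs_apply: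
  assumes "cring R" "finite A" "\<And>i. i \<in> A \<Longrightarrow> h i \<in> carrier (free_on_pairs R M N)"
  shows "(\<Oplus>\<^bsub>free_on_pairs R M N\<^esub>i\<in>A. h i) p = (\<Oplus>\<^bsub>R\<^esub>i\<in>A. h i p)"
proof -
  interpret R: cring R by fact
  interpret F: module R "free_on_pairs R M N" by (rule free_on_pairs_module) fact
  show ?thesis using assms(2,3)
  proof (induction A rule: finite_induct)
    case (insert i A)
    then have "h \<in> A \<rightarrow> carrier (free_on_pairs R M N)" "(\<lambda>i. h i p) \<in> A \<rightarrow> carrier R" "h i p \<in> carrier R"
      using free_on_pairs_apply by blast+
    with insert show ?case by (simp add: free_on_pairs_simps)
  qed (simp add: free_on_pairs_simps)
qed

lemma free_on_pairs_expand:
  assumes "cring R" "f \<in> carrier (free_on_pairs R M N)" "finite A" "{p. f p \<noteq> \<zero>\<^bsub>R\<^esub>} \<subseteq> A"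
    "A \<subseteq> carrier M \<times> carrier N"
  shows "f = (\<Oplus>\<^bsub>free_on_pairs R M N\<^esub>p\<in>A. f p \<odot>\<^bsub>free_on_pairs R M N\<^esub> single R p)"
proof
  fix q
  interpret R: cring R by fact
  interpret F: module R "free_on_pairs R M N" by (rule free_on_pairs_module) fact
  have fR: "f p \<in> carrier R" for p using assms(2) by (rule free_on_pairs_apply)
  have "(\<Oplus>\<^bsub>free_on_pairs R M N\<^esub>p\<in>A. f p \<odot>\<^bsub>free_on_pairs R M N\<^esub> single R p) q =
      (\<Oplus>\<^bsub>R\<^esub>p\<in>A. (f p \<odot>\<^bsub>free_on_pairs R M N\<^esub> single R p) q)"
    using assms(3,5) fR by (intro finsum_free_on_pairs_apply assms(1))
        (auto intro!: F.smult_closed single_closed assms(1))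
  also have "\<dots> = (\<Oplus>\<^bsub>R\<^esub>p\<in>A. if q = p then f p else \<zero>\<^bsub>R\<^esub>)"
    using fR by (intro R.finsum_cong') (auto simp: free_on_pairs_simps single_def)
  also have "\<dots> = f q"
  proof (cases "q \<in> A")
    case True
    then show ?thesis using R.finsum_singleton[OF True assms(3), of f] fR by auto
  next
    case False
    then have "(\<Oplus>\<^bsub>R\<^esub>p\<in>A. if q = p then f p else \<zero>\<^bsub>R\<^esub>) = (\<Oplus>\<^bsub>R\<^esub>p\<in>A. \<zero>\<^bsub>R\<^esub>)"
      by (intro R.finsum_cong') auto
    moreover have "f q = \<zero>\<^bsub>R\<^esub>" using False assms(4) by blast
    ultimately show ?thesis by simp
  qed
  finally show "f q = (\<Oplus>\<^bsub>free_on_pairs R M N\<^esub>p\<in>A. f p \<odot>\<^bsub>free_on_pairs R M N\<^esub> single R p) q" ..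
qed

section \<open>Bilinear maps and their extension to formal sums\<close>

definition bilinear_map ::
  "('r, 'k) ring_scheme \<Rightarrow> ('r, 'a, 'm) module_scheme \<Rightarrow> ('r, 'b, 'n) module_scheme
    \<Rightarrow> ('r, 'p, 'l) module_scheme \<Rightarrow> ('a \<Rightarrow> 'b \<Rightarrow> 'p) \<Rightarrow> bool" where
  "bilinear_map R M N P \<beta> \<longleftrightarrow>
     (\<forall>y\<in>carrier N. linear_map R M P (\<lambda>x. \<beta> x y)) \<and> (\<forall>x\<in>carrier M. linear_map R N P (\<beta> x))"

lemma bilinear_mapI:
  assumes "\<And>y. y \<in> carrier N \<Longrightarrow> linear_map R M P (\<lambda>x. \<beta> x y)"
    and "\<And>x. x \<in> carrier M \<Longrightarrow> linear_map R N P (\<lambda>y. \<beta> x y)"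
  shows "bilinear_map R M N P \<beta>"
  using assms by (simp add: bilinear_map_def)

lemma bilinear_map_left: "\<lbrakk>bilinear_map R M N P \<beta>; y \<in> carrier N\<rbrakk> \<Longrightarrow> linear_map R M P (\<lambda>x. \<beta> x y)"
  and bilinear_map_right: "\<lbrakk>bilinear_map R M N P \<beta>; x \<in> carrier M\<rbrakk> \<Longrightarrow> linear_map R N P (\<lambda>y. \<beta> x y)"
  by (simp_all add: bilinear_map_def)

lemma bilinear_map_closed:
  "\<lbrakk>bilinear_map R M N P \<beta>; x \<in> carrier M; y \<in> carrier N\<rbrakk> \<Longrightarrow> \<beta> x y \<in> carrier P"
  using bilinear_map_left linear_map_closed by metis

lemma bilinear_map_comp:
  assumes "bilinear_map R M N P \<beta>" "linear_map R M' M f" "linear_map R N' N g"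
  shows "bilinear_map R M' N' P (\<lambda>x y. \<beta> (f x) (g y))"
  using linear_map_comp[OF assms(2) bilinear_map_left[OF assms(1)]]
    linear_map_comp[OF assms(3) bilinear_map_right[OF assms(1)]]
    linear_map_closed[OF assms(2)] linear_map_closed[OF assms(3)]
  by (intro bilinear_mapI) auto

lemma bilinear_map_post:
  assumes "bilinear_map R M N P \<beta>" "linear_map R P Q f"
  shows "bilinear_map R M N Q (\<lambda>x y. f (\<beta> x y))"
  using bilinear_map_left[OF assms(1), THEN linear_map_comp, OF _ assms(2)]
   bilinear_map_right[OF assms(1), THEN linear_map_comp, OF _ assms(2)]
  by (intro bilinear_mapI) auto

text \<open>The expression inside \<open>tensor_lift\<close>, isolated on single formal sums so that
  it can be shown linear before cosets enter.\<close>

definition formal_sum_eval where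
  "formal_sum_eval R P \<beta> f = (\<Oplus>\<^bsub>P\<^esub>p\<in>{p. f p \<noteq> \<zero>\<^bsub>R\<^esub>}. f p \<odot>\<^bsub>P\<^esub> \<beta> (fst p) (snd p))"

text \<open>The supports of \<open>f\<close>, \<open>g\<close> and \<open>f + g\<close> may differ,
  by cancellation for instance, so additivity becomes visible only after all three sums are extended
  by zero terms to one index set.\<close>

lemma formal_sum_eval_superset:
  assumes "module R P" "f \<in> carrier (free_on_pairs R M N)" "finite A" "{p. f p \<noteq> \<zero>\<^bsub>R\<^esub>} \<subseteq> A"
    "\<And>p. p \<in> A \<Longrightarrow> \<beta> (fst p) (snd p) \<in> carrier P"
  shows "formal_sum_eval R P \<beta> f = (\<Oplus>\<^bsub>P\<^esub>p\<in>A. f p \<odot>\<^bsub>P\<^esub> \<beta> (fst p) (snd p))"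
proof -
  interpret P: module R P by fact
  show ?thesis
    unfolding formal_sum_eval_def using assms
    by (intro P.add.finprod_mono_neutral_cong_left) (auto simp: free_on_pairs_simps)
qed

text \<open>The universal property of the free module: any function on pairs with values in
  \<open>P\<close> extends linearly. Bilinearity enters when the relations have to be
  killed.\<close>

lemma formal_sum_eval_linear:
  assumes P: "module R P" and \<beta>: "\<And>x y. \<lbrakk>x \<in> carrier M; y \<in> carrier N\<rbrakk> \<Longrightarrow> \<beta> x y \<in> carrier P"
  shows "linear_map R (free_on_pairs R M N) P (formal_sum_eval R P \<beta>)"
proof -
  interpret P: module R P by fact
  interpret F: module R "free_on_pairs R M N" by (rule free_on_pairs_module) unfold_locales
  let ?F = "free_on_pairs R M N" and ?s = "\<lambda>f. {p. f p \<noteq> \<zero>\<^bsub>R\<^esub>}"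
  have s: "f p \<in> carrier R" "finite (?s f)" "p \<in> ?s f \<Longrightarrow> \<beta> (fst p) (snd p) \<in> carrier P"
    if "f \<in> carrier ?F" for f p
    using free_on_pairs_apply[OF that] free_on_pairs_finite[OF that] free_on_pairs_support[OF that] \<beta>
    by (auto simp: mem_Times_iff)
  show ?thesis
  proof (rule linear_mapI)
    fix f assume f: "f \<in> carrier ?F"
    show "formal_sum_eval R P \<beta> f \<in> carrier P"
      unfolding formal_sum_eval_def using s[OF f] by (intro P.finsum_closed) auto
    fix g assume g: "g \<in> carrier ?F"
    let ?A = "?s f \<union> ?s g"
    have "formal_sum_eval R P \<beta> (f \<oplus>\<^bsub>?F\<^esub> g) = (\<Oplus>\<^bsub>P\<^esub>p\<in>?A. (f p \<oplus>\<^bsub>R\<^esub> g p) \<odot>\<^bsub>P\<^esub> \<beta> (fst p) (snd p))"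
      using s[OF f] s[OF g]
      by (subst formal_sum_eval_superset[OF P F.a_closed[OF f g], of ?A]) (auto simp: free_on_pairs_simps)
    also have "\<dots> = (\<Oplus>\<^bsub>P\<^esub>p\<in>?A. f p \<odot>\<^bsub>P\<^esub> \<beta> (fst p) (snd p) \<oplus>\<^bsub>P\<^esub> g p \<odot>\<^bsub>P\<^esub> \<beta> (fst p) (snd p))"
      using s[OF f] s[OF g] by (intro P.finsum_cong') (auto simp: P.smult_l_distr)
    also have "\<dots> = (\<Oplus>\<^bsub>P\<^esub>p\<in>?A. f p \<odot>\<^bsub>P\<^esub> \<beta> (fst p) (snd p)) \<oplus>\<^bsub>P\<^esub>
        (\<Oplus>\<^bsub>P\<^esub>p\<in>?A. g p \<odot>\<^bsub>P\<^esub> \<beta> (fst p) (snd p))"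
      using s[OF f] s[OF g] by (intro P.finsum_addf) auto
    also have "\<dots> = formal_sum_eval R P \<beta> f \<oplus>\<^bsub>P\<^esub> formal_sum_eval R P \<beta> g"
      using s[OF f] s[OF g] formal_sum_eval_superset[OF P f, of ?A \<beta>] formal_sum_eval_superset[OF P
          g, of ?A \<beta>]
      by fastforce
    finally show "formal_sum_eval R P \<beta> (f \<oplus>\<^bsub>?F\<^esub> g) = formal_sum_eval R P \<beta> f
        \<oplus>\<^bsub>P\<^esub> formal_sum_eval R P \<beta> g" .
  next
    fix a f assume a: "a \<in> carrier R" and f: "f \<in> carrier ?F"
    have "formal_sum_eval R P \<beta> (a \<odot>\<^bsub>?F\<^esub> f) = (\<Oplus>\<^bsub>P\<^esub>p\<in>?s f. (a \<otimes>\<^bsub>R\<^esub> f p) \<odot>\<^bsub>P\<^esub> \<beta> (fst p) (snd p))"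
      using s[OF f] a
      by (subst formal_sum_eval_superset[OF P F.smult_closed[OF a f], of "?s f"])
          (auto simp: free_on_pairs_simps)
    also have "\<dots> = (\<Oplus>\<^bsub>P\<^esub>p\<in>?s f. a \<odot>\<^bsub>P\<^esub> (f p \<odot>\<^bsub>P\<^esub> \<beta> (fst p) (snd p)))"
      using s[OF f] a by (intro P.finsum_cong') (auto simp: P.smult_assoc1)
    also have "\<dots> = a \<odot>\<^bsub>P\<^esub> formal_sum_eval R P \<beta> f"
      unfolding formal_sum_eval_def using s[OF f] a
      by (subst P.finsum_smult_ldistr) auto
    finally show "formal_sum_eval R P \<beta> (a \<odot>\<^bsub>?F\<^esub> f) = a \<odot>\<^bsub>P\<^esub> formal_sum_eval R P \<beta> f" .
  qed
qed

lemma formal_sum_eval_single: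
  assumes P: "module R P" and \<beta>: "\<beta> x y \<in> carrier P"
  shows "formal_sum_eval R P \<beta> (single R (x, y)) = \<beta> x y"
proof -
  interpret P: module R P by fact
  show ?thesis
  proof (cases "\<one>\<^bsub>R\<^esub> = \<zero>\<^bsub>R\<^esub>")
    case True
    \<comment> \<open>Over the zero ring \<open>single\<close> has empty support and the evaluation
      is an empty sum; it still has the right value because \<open>1 = 0\<close> forces every
      element of \<open>P\<close> to vanish.\<close>
    then have "\<beta> x y = \<zero>\<^bsub>P\<^esub>" using P.smult_one[OF \<beta>] P.smult_l_null[OF \<beta>] by simp
    with True show ?thesis by (simp add: formal_sum_eval_def single_def)
  next
    case False
    then have "{p. single R (x, y) p \<noteq> \<zero>\<^bsub>R\<^esub>} = {(x, y)}" by (auto simp: single_def)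
    then show ?thesis using \<beta> by (simp add: formal_sum_eval_def single_def)
  qed
qed

section \<open>The tensor product of two modules as a quotient of the free module\<close>

locale two_modules = M: module R M + N: module R N
  for R (structure) and M (structure) and N (structure)
begin

abbreviation F where "F \<equiv> free_on_pairs R M N"
abbreviation K where "K \<equiv> tensor_kernel R M N"
abbreviation T where "T \<equiv> tensor R M N"

lemma R_cring: "cring R" ..

sublocale F: module R F by (rule free_on_pairs_module) unfold_locales

lemma bilinearity_relations_closed: "bilinearity_relations R M N \<subseteq> carrier F"
  by (auto simp: bilinearity_relations_def Let_def
      intro!: F.minus_closed F.a_closed F.smult_closed single_closed R_cring)

lemma bilinearity_relationsI:
  "\<lbrakk>x \<in> carrier M; x' \<in> carrier M; y \<in> carrier N\<rbrakk> \<Longrightarrow>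
    single R (x \<oplus>\<^bsub>M\<^esub> x', y) \<ominus>\<^bsub>F\<^esub> (single R (x, y) \<oplus>\<^bsub>F\<^esub> single R (x', y)) \<in> bilinearity_relations R M N"
  "\<lbrakk>x \<in> carrier M; y \<in> carrier N; y' \<in> carrier N\<rbrakk> \<Longrightarrow>
    single R (x, y \<oplus>\<^bsub>N\<^esub> y') \<ominus>\<^bsub>F\<^esub> (single R (x, y) \<oplus>\<^bsub>F\<^esub> single R (x, y')) \<in> bilinearity_relations R M N"
  "\<lbrakk>a \<in> carrier R; x \<in> carrier M; y \<in> carrier N\<rbrakk> \<Longrightarrow>
    single R (a \<odot>\<^bsub>M\<^esub> x, y) \<ominus>\<^bsub>F\<^esub> a \<odot>\<^bsub>F\<^esub> single R (x, y) \<in> bilinearity_relations R M N"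
  "\<lbrakk>a \<in> carrier R; x \<in> carrier M; y \<in> carrier N\<rbrakk> \<Longrightarrow>
    single R (x, a \<odot>\<^bsub>N\<^esub> y) \<ominus>\<^bsub>F\<^esub> a \<odot>\<^bsub>F\<^esub> single R (x, y) \<in> bilinearity_relations R M N"
  unfolding bilinearity_relations_def Let_def by blast+

lemma kernel_submodule: "submodule K R F"
  unfolding tensor_kernel_def
  by (rule submodule_span_submodule[OF F.module_axioms bilinearity_relations_closed])

lemma tensor_eq: "T = quotient_algebra F K" by (simp add: tensor_def)

lemma tensor_module: "module R T"
  unfolding tensor_eq by (rule F.quotient_module[OF kernel_submodule])

sublocale T: module R T by (rule tensor_module)

lemma class_linear: "linear_map R F T (\<lambda>f. K +>\<^bsub>F\<^esub> f)"
  unfolding tensor_eq by (rule F.quotient_proj_linear[OF kernel_submodule])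

lemma pure_closed: "\<lbrakk>x \<in> carrier M; y \<in> carrier N\<rbrakk> \<Longrightarrow> pure R M N x y \<in> carrier T"
  unfolding pure_def by (intro linear_map_closed[OF class_linear] single_closed R_cring)

lemma relation_class_eq:
  assumes "f \<in> carrier F" "g \<in> carrier F" "f \<ominus>\<^bsub>F\<^esub> g \<in> bilinearity_relations R M N"
  shows "K +>\<^bsub>F\<^esub> f = K +>\<^bsub>F\<^esub> g"
  using assms(1,2) subsetD[OF submodule_span_superset assms(3)]
  by (subst F.coset_eq_iff[OF kernel_submodule]) (auto simp: tensor_kernel_def)

lemma pure_bilinear: "bilinear_map R M N T (pure R M N)"
proof (rule bilinear_mapI; rule linear_mapI)
  note [intro!] = single_closed R_cring
  fix x x' y assume *: "y \<in> carrier N" "x \<in> carrier M" "x' \<in> carrier M"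
  have "K +>\<^bsub>F\<^esub> single R (x \<oplus>\<^bsub>M\<^esub> x', y) = K +>\<^bsub>F\<^esub> (single R (x, y) \<oplus>\<^bsub>F\<^esub> single R (x', y))"
    using * by (intro relation_class_eq) (auto intro: bilinearity_relationsI)
  then show "pure R M N (x \<oplus>\<^bsub>M\<^esub> x') y = pure R M N x y \<oplus>\<^bsub>T\<^esub> pure R M N x' y"
    using * unfolding pure_def by (subst linear_map_add[OF class_linear, symmetric]) auto
next
  note [intro!] = single_closed R_cring
  fix x y y' assume *: "x \<in> carrier M" "y \<in> carrier N" "y' \<in> carrier N"
  have "K +>\<^bsub>F\<^esub> single R (x, y \<oplus>\<^bsub>N\<^esub> y') = K +>\<^bsub>F\<^esub> (single R (x, y) \<oplus>\<^bsub>F\<^esub> single R (x, y'))"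
    using * by (intro relation_class_eq) (auto intro: bilinearity_relationsI)
  then show "pure R M N x (y \<oplus>\<^bsub>N\<^esub> y') = pure R M N x y \<oplus>\<^bsub>T\<^esub> pure R M N x y'"
    using * unfolding pure_def by (subst linear_map_add[OF class_linear, symmetric]) auto
next
  note [intro!] = single_closed R_cring
  fix a x y assume *: "y \<in> carrier N" "a \<in> carrier R" "x \<in> carrier M"
  have "K +>\<^bsub>F\<^esub> single R (a \<odot>\<^bsub>M\<^esub> x, y) = K +>\<^bsub>F\<^esub> (a \<odot>\<^bsub>F\<^esub> single R (x, y))"
    using * by (intro relation_class_eq) (auto intro: bilinearity_relationsI)
  then show "pure R M N (a \<odot>\<^bsub>M\<^esub> x) y = a \<odot>\<^bsub>T\<^esub> pure R M N x y"
    using * unfolding pure_def by (subst linear_map_smult[OF class_linear, symmetric]) auto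
next
  note [intro!] = single_closed R_cring
  fix a x y assume *: "x \<in> carrier M" "a \<in> carrier R" "y \<in> carrier N"
  have "K +>\<^bsub>F\<^esub> single R (x, a \<odot>\<^bsub>N\<^esub> y) = K +>\<^bsub>F\<^esub> (a \<odot>\<^bsub>F\<^esub> single R (x, y))"
    using * by (intro relation_class_eq) (auto intro: bilinearity_relationsI)
  then show "pure R M N x (a \<odot>\<^bsub>N\<^esub> y) = a \<odot>\<^bsub>T\<^esub> pure R M N x y"
    using * unfolding pure_def by (subst linear_map_smult[OF class_linear, symmetric]) auto
qed (simp_all add: pure_closed)

lemma class_eq_sum:
  assumes "f \<in> carrier F" "finite A" "{p. f p \<noteq> \<zero>\<^bsub>R\<^esub>} \<subseteq> A" "A \<subseteq> carrier M \<times> carrier N"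
  shows "K +>\<^bsub>F\<^esub> f = (\<Oplus>\<^bsub>T\<^esub>p\<in>A. f p \<odot>\<^bsub>T\<^esub> pure R M N (fst p) (snd p))"
proof -
  have fR: "f p \<in> carrier R" for p using assms(1) by (rule free_on_pairs_apply)
  have s: "single R p \<in> carrier F" if "p \<in> A" for p
    using that assms(4) by (cases p) (auto intro!: single_closed R_cring)
  have "K +>\<^bsub>F\<^esub> f = K +>\<^bsub>F\<^esub> (\<Oplus>\<^bsub>F\<^esub>p\<in>A. f p \<odot>\<^bsub>F\<^esub> single R p)"
    by (rule arg_cong[OF free_on_pairs_expand[OF R_cring assms]])
  also have "\<dots> = (\<Oplus>\<^bsub>T\<^esub>p\<in>A. K +>\<^bsub>F\<^esub> (f p \<odot>\<^bsub>F\<^esub> single R p))"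
    using s fR assms(2) by (intro linear_map_finsum[OF F.module_axioms tensor_module class_linear]) auto
  also have "\<dots> = (\<Oplus>\<^bsub>T\<^esub>p\<in>A. f p \<odot>\<^bsub>T\<^esub> pure R M N (fst p) (snd p))"
    using s fR assms(4) pure_closed by (intro T.finsum_cong') (auto simp: pure_def
        linear_map_smult[OF class_linear])
  finally show ?thesis .
qed

text \<open>Two cases suffice: zero is the pure tensor of two zeros, and the coefficient of a pure
  tensor can be absorbed into its left factor.\<close>

lemma tensor_induct [consumes 1, case_names pure add]:
  assumes "t \<in> carrier T"
    and "\<And>x y. \<lbrakk>x \<in> carrier M; y \<in> carrier N\<rbrakk> \<Longrightarrow> Q (pure R M N x y)"
    and "\<And>s t. \<lbrakk>s \<in> carrier T; t \<in> carrier T; Q s; Q t\<rbrakk> \<Longrightarrow> Q (s \<oplus>\<^bsub>T\<^esub> t)"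
  shows "Q t"
proof -
  obtain f where f: "f \<in> carrier F" "t = K +>\<^bsub>F\<^esub> f"
    using assms(1) F.quotient_carrier[OF kernel_submodule] by (auto simp: tensor_eq)
  define A where "A = {p. f p \<noteq> \<zero>}"
  have A: "finite A" "A \<subseteq> carrier M \<times> carrier N" and fR: "\<And>p. f p \<in> carrier R"
    using free_on_pairs_apply[OF f(1)] free_on_pairs_finite[OF f(1)] free_on_pairs_support[OF f(1)]
    by (auto simp: A_def)
  have "(\<Oplus>\<^bsub>T\<^esub>p\<in>A. f p \<odot>\<^bsub>T\<^esub> pure R M N (fst p) (snd p)) \<in> {t \<in> carrier T. Q t}"
    using A
  proof (induction A rule: finite_induct)
    case empty
    have "\<zero>\<^bsub>T\<^esub> = pure R M N \<zero>\<^bsub>M\<^esub> \<zero>\<^bsub>N\<^esub>"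
      using linear_map_zero[OF M.module_axioms tensor_module bilinear_map_left[OF pure_bilinear]] by simp
    then show ?case using assms(2) pure_closed by simp
  next
    case (insert p A)
    have "f p \<odot>\<^bsub>T\<^esub> pure R M N (fst p) (snd p) = pure R M N (f p \<odot>\<^bsub>M\<^esub> fst p) (snd p)"
      using insert fR by (subst linear_map_smult[OF bilinear_map_left[OF pure_bilinear]]) auto
    then have "f p \<odot>\<^bsub>T\<^esub> pure R M N (fst p) (snd p) \<in> {t \<in> carrier T. Q t}"
      using insert fR assms(2) pure_closed by auto
    moreover have "(\<lambda>p. f p \<odot>\<^bsub>T\<^esub> pure R M N (fst p) (snd p)) \<in> A \<rightarrow> carrier T"
      using insert fR pure_closed by auto
    ultimately show ?case
      using insert assms(3) by simp
  qed
  moreover have "t = (\<Oplus>\<^bsub>T\<^esub>p\<in>A. f p \<odot>\<^bsub>T\<^esub> pure R M N (fst p) (snd p))"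
    using f(2) class_eq_sum[OF f(1) A(1) _ A(2)] by (simp add: A_def)
  ultimately show ?thesis by simp
qed

text \<open>The uniqueness half of the universal property: pure tensors generate additively.\<close>

lemma tensor_ext:
  assumes "linear_map R T P f" "linear_map R T P g"
    and "\<And>x y. \<lbrakk>x \<in> carrier M; y \<in> carrier N\<rbrakk> \<Longrightarrow> f (pure R M N x y) = g (pure R M N x y)"
    and "t \<in> carrier T"
  shows "f t = g t"
  using assms(4)
  by (induction rule: tensor_induct)
    (simp_all add: assms(3) linear_map_add[OF assms(1)] linear_map_add[OF assms(2)])

text \<open>Each of the four families of relations is an instance of additivity or homogeneity of
  \<open>\<beta>\<close> in one argument. The kernel of the evaluation is a submodule, hence
  contains their span.\<close>

lemma formal_sum_eval_kernel:
  assumes P: "module R P" and \<beta>: "bilinear_map R M N P \<beta>" and "k \<in> K"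
  shows "formal_sum_eval R P \<beta> k = \<zero>\<^bsub>P\<^esub>"
proof -
  interpret P: module R P by fact
  let ?e = "formal_sum_eval R P \<beta>"
  have lin: "linear_map R F P ?e"
    using bilinear_map_closed[OF \<beta>] by (intro formal_sum_eval_linear P)
  have e: "?e (single R (x, y)) = \<beta> x y" if "x \<in> carrier M" "y \<in> carrier N" for x y
    using that by (intro formal_sum_eval_single P bilinear_map_closed[OF \<beta>])
  have eq: "?e (f \<ominus>\<^bsub>F\<^esub> g) = \<zero>\<^bsub>P\<^esub>" if "f \<in> carrier F" "g \<in> carrier F" "?e f = ?e g" for f g
    using that linear_map_closed[OF lin] by (simp add:
        linear_map_diff[OF F.module_axioms P lin] P.r_neg a_minus_def[of P])
  note s = single_closed[OF R_cring] linear_map_add[OF lin] linear_map_smult[OF lin] e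
    linear_map_add[OF bilinear_map_left[OF \<beta>]] linear_map_smult[OF bilinear_map_left[OF \<beta>]]
    linear_map_add[OF bilinear_map_right[OF \<beta>]] linear_map_smult[OF bilinear_map_right[OF \<beta>]]
  have "?e r = \<zero>\<^bsub>P\<^esub>" if "r \<in> bilinearity_relations R M N" for r
    using that unfolding bilinearity_relations_def Let_def
    by (elim UnE CollectE exE conjE; hypsubst; intro eq) (simp_all add: s)
  then have "bilinearity_relations R M N \<subseteq> {f \<in> carrier F. ?e f = \<zero>\<^bsub>P\<^esub>}"
    using bilinearity_relations_closed by blast
  then show ?thesis
    using submodule_span_least[OF linear_map_ker_submodule[OF F.module_axioms P lin]] assms(3)
    unfolding tensor_kernel_def by blast
qed

lemma tensor_lift_class:
  assumes P: "module R P" and \<beta>: "bilinear_map R M N P \<beta>" and f: "f \<in> carrier F"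
  shows "tensor_lift R P \<beta> (K +>\<^bsub>F\<^esub> f) = formal_sum_eval R P \<beta> f"
  using F.linear_map_the_elem_coset[OF kernel_submodule P formal_sum_eval_linear formal_sum_eval_kernel f]
    P \<beta> bilinear_map_closed[OF \<beta>]
  by (simp add: tensor_lift_def formal_sum_eval_def[abs_def])

lemma tensor_lift_linear:
  assumes P: "module R P" and \<beta>: "bilinear_map R M N P \<beta>"
  shows "linear_map R T P (tensor_lift R P \<beta>)"
proof -
  have lin: "linear_map R F P (formal_sum_eval R P \<beta>)"
    using bilinear_map_closed[OF \<beta>] by (intro formal_sum_eval_linear P)
  have T: "\<exists>f\<in>carrier F. t = K +>\<^bsub>F\<^esub> f" if "t \<in> carrier T" for t
    using that F.quotient_carrier[OF kernel_submodule] by (auto simp: tensor_eq)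
  note E = tensor_lift_class[OF P \<beta>]
  show ?thesis
    by (rule linear_mapI)
      (auto dest!: T simp: E linear_map_closed[OF lin] linear_map_add[OF lin] linear_map_smult[OF lin]
        linear_map_add[OF class_linear, symmetric] linear_map_smult[OF class_linear, symmetric])
qed

lemma tensor_lift_pure:
  assumes P: "module R P" and \<beta>: "bilinear_map R M N P \<beta>" and "x \<in> carrier M" "y \<in> carrier N"
  shows "tensor_lift R P \<beta> (pure R M N x y) = \<beta> x y"
  using assms(3,4) unfolding pure_def
  by (subst tensor_lift_class[OF P \<beta>])
    (auto intro!: single_closed R_cring formal_sum_eval_single P bilinear_map_closed[OF \<beta>])

end

section \<open>Functoriality of the tensor product\<close>

lemma two_modulesI: "\<lbrakk>module R M; module R N\<rbrakk> \<Longrightarrow> two_modules R M N"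
  by (simp add: two_modules_def)

lemmas tensor_is_module = two_modules.tensor_module[OF two_modulesI]
  and pure_in_tensor = two_modules.pure_closed[OF two_modulesI]
  and pure_is_bilinear = two_modules.pure_bilinear[OF two_modulesI]
  and lift_linear = two_modules.tensor_lift_linear[OF two_modulesI]
  and lift_pure = two_modules.tensor_lift_pure[OF two_modulesI]
  and tensor_eqI = two_modules.tensor_ext[OF two_modulesI]

context two_modules
begin

lemma tensor_lift_cong:
  assumes P: "module R P" and \<beta>: "bilinear_map R M N P \<beta>" and \<gamma>: "bilinear_map R M N P \<gamma>"
    and "\<And>x y. \<lbrakk>x \<in> carrier M; y \<in> carrier N\<rbrakk> \<Longrightarrow> \<beta> x y = \<gamma> x y" and t: "t \<in> carrier T"
  shows "tensor_lift R P \<beta> t = tensor_lift R P \<gamma> t"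
  by (rule tensor_ext[OF tensor_lift_linear[OF P \<beta>] tensor_lift_linear[OF P \<gamma>] _ t])
    (simp add: tensor_lift_pure[OF P] assms)

lemma tensor_lift_post:
  assumes P: "module R P" and Q: "module R Q" and \<beta>: "bilinear_map R M N P \<beta>"
    and h: "linear_map R P Q h" and t: "t \<in> carrier T"
  shows "h (tensor_lift R P \<beta> t) = tensor_lift R Q (\<lambda>x y. h (\<beta> x y)) t"
  by (rule tensor_ext[OF linear_map_comp[OF tensor_lift_linear[OF P \<beta>] h]
        tensor_lift_linear[OF Q bilinear_map_post[OF \<beta> h]] _ t])
    (simp add: tensor_lift_pure[OF P \<beta>] tensor_lift_pure[OF Q bilinear_map_post[OF \<beta> h]])

text \<open>In \<open>tensor_assoc\<close> and \<open>tmul\<close> an inner lift depends on a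
  variable of the outer one. Linearity in that parameter follows by induction on the tensor, since
  sums of linear maps are linear, and it makes the outer function bilinear.\<close>

lemma tensor_lift_param:
  assumes L: "module R L" and P: "module R P"
    and \<beta>: "\<And>z. z \<in> carrier L \<Longrightarrow> bilinear_map R M N P (\<beta> z)"
    and lin: "\<And>x y. \<lbrakk>x \<in> carrier M; y \<in> carrier N\<rbrakk> \<Longrightarrow> linear_map R L P (\<lambda>z. \<beta> z x y)"
    and t: "t \<in> carrier T"
  shows "linear_map R L P (\<lambda>z. tensor_lift R P (\<beta> z) t)"
  using t
proof (induction rule: tensor_induct)
  case (pure x y)
  then show ?case
    by (intro linear_map_eq[OF lin[OF pure] _ L]) (simp add: tensor_lift_pure[OF P \<beta>])
next
  case (add s t)
  then show ?case
    by (intro linear_map_eq[OF linear_map_plus[OF P add(3,4)] _ L])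
      (simp add: linear_map_add[OF tensor_lift_linear[OF P \<beta>]])
qed

end

lemma bilinear_map_pure_comp:
  "\<lbrakk>module R M'; module R N'; linear_map R M M' f; linear_map R N N' g\<rbrakk>
    \<Longrightarrow> bilinear_map R M N (tensor R M' N') (\<lambda>x y. pure R M' N' (f x) (g y))"
  by (intro bilinear_map_comp[OF pure_is_bilinear])

locale linear_map_pair = two_modules R M N + tgt: two_modules R M' N'
  for R (structure) and M (structure) and N (structure) and M' (structure) and N' (structure) +
  fixes f g
  assumes f: "linear_map R M M' f" and g: "linear_map R N N' g"
begin

lemma bilin: "bilinear_map R M N (tensor R M' N') (\<lambda>x y. pure R M' N' (f x) (g y))"
  by (intro bilinear_map_pure_comp f g tgt.M.module_axioms tgt.N.module_axioms)

lemma tensor_map_linear: "linear_map R T (tensor R M' N') (tensor_map R M' N' f g)"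
  unfolding tensor_map_def by (rule tensor_lift_linear[OF tgt.tensor_module bilin])

lemma tensor_map_pure:
  "\<lbrakk>x \<in> carrier M; y \<in> carrier N\<rbrakk> \<Longrightarrow>
     tensor_map R M' N' f g (pure R M N x y) = pure R M' N' (f x) (g y)"
  unfolding tensor_map_def by (rule tensor_lift_pure[OF tgt.tensor_module bilin])

text \<open>Substitution under the lift: values at \<open>(f \<otimes> g)(t)\<close> are computed
  from \<open>t\<close> itself, in particular convolution on a quotient from the coproduct
  upstairs.\<close>

lemma tensor_lift_tensor_map:
  assumes P: "module R P" and \<beta>: "bilinear_map R M' N' P \<beta>" and t: "t \<in> carrier T"
  shows "tensor_lift R P \<beta> (tensor_map R M' N' f g t) = tensor_lift R P (\<lambda>x y. \<beta> (f x) (g y)) t"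
proof (rule tensor_ext[OF _ _ _ t])
  have b: "bilinear_map R M N P (\<lambda>x y. \<beta> (f x) (g y))" by (rule bilinear_map_comp[OF \<beta> f g])
  show "linear_map R T P (tensor_lift R P (\<lambda>x y. \<beta> (f x) (g y)))" by (rule tensor_lift_linear[OF P b])
  show "linear_map R T P (\<lambda>t. tensor_lift R P \<beta> (tensor_map R M' N' f g t))"
    by (rule linear_map_comp[OF tensor_map_linear tgt.tensor_lift_linear[OF P \<beta>]])
  fix x y assume "x \<in> carrier M" "y \<in> carrier N"
  then show "tensor_lift R P \<beta> (tensor_map R M' N' f g (pure R M N x y)) =
      tensor_lift R P (\<lambda>x y. \<beta> (f x) (g y)) (pure R M N x y)"
    by (simp add: tensor_map_pure tensor_lift_pure[OF P b] tgt.tensor_lift_pure[OF P \<beta>]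
        linear_map_closed[OF f] linear_map_closed[OF g])
qed

end

lemma linear_map_pairI:
  "\<lbrakk>module R M; module R N; module R M'; module R N'; linear_map R M M' f; linear_map R N N' g\<rbrakk>
    \<Longrightarrow> linear_map_pair R M N M' N' f g"
  by (simp add: linear_map_pair_def linear_map_pair_axioms_def two_modules_def)

lemmas tensor_map_is_linear = linear_map_pair.tensor_map_linear[OF linear_map_pairI]
  and tensor_map_of_pure = linear_map_pair.tensor_map_pure[OF linear_map_pairI]
  and lift_tensor_map = linear_map_pair.tensor_lift_tensor_map[OF linear_map_pairI]

lemma tensor_map_comp:
  assumes "module R M" "module R N" "module R M'" "module R N'" "module R M''" "module R N''"
    and "linear_map R M M' f" "linear_map R N N' g" "linear_map R M' M'' f'" "linear_map R N' N'' g'"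
    and "t \<in> carrier (tensor R M N)"
  shows "tensor_map R M'' N'' f' g' (tensor_map R M' N' f g t) =
    tensor_map R M'' N'' (\<lambda>x. f' (f x)) (\<lambda>y. g' (g y)) t"
  unfolding tensor_map_def[of R M'' N'']
  by (intro lift_tensor_map[where M = M and N = N and M' = M' and N' = N']
      tensor_is_module bilinear_map_pure_comp assms)

lemma tensor_map_cong:
  assumes "module R M" "module R N" "module R M'" "module R N'"
    and "linear_map R M M' f" "linear_map R N N' g"
    and "\<And>x. x \<in> carrier M \<Longrightarrow> f x = f' x" "\<And>y. y \<in> carrier N \<Longrightarrow> g y = g' y"
    and "t \<in> carrier (tensor R M N)"
  shows "tensor_map R M' N' f g t = tensor_map R M' N' f' g' t"
  unfolding tensor_map_def
proof (rule two_modules.tensor_lift_cong[OF two_modulesI])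
  have "linear_map R M M' f'" "linear_map R N N' g'"
    using assms(7,8) by (auto intro: linear_map_eq[OF assms(5) _ assms(1)]
        linear_map_eq[OF assms(6) _ assms(2)])
  then show "bilinear_map R M N (tensor R M' N') (\<lambda>x y. pure R M' N' (f' x) (g' y))"
    by (intro bilinear_map_pure_comp assms)
qed (use assms in \<open>auto intro: bilinear_map_pure_comp tensor_is_module\<close>)

section \<open>Threefold tensor products and the associator\<close>

locale three_modules = L: module R L + M: module R M + N: module R N
  for R (structure) and L (structure) and M (structure) and N (structure)
begin

lemma mods: "module R L" "module R M" "module R N" ..

abbreviation LM where "LM \<equiv> tensor R L M"
abbreviation MN where "MN \<equiv> tensor R M N"
abbreviation T3 where "T3 \<equiv> tensor R LM N"
abbreviation T3' where "T3' \<equiv> tensor R L MN"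

lemma tensor_mods: "module R LM" "module R MN" "module R T3" "module R T3'"
  by (intro tensor_is_module mods)+

text \<open>For fixed \<open>z\<close> both sides are linear in the element of
  \<open>L \<otimes> M\<close>, so agreement on pure tensors is used twice, once outside and once
  inside.\<close>

lemma tensor3_ext:
  assumes P: "module R P" and f: "linear_map R T3 P f" and g: "linear_map R T3 P g"
    and eq: "\<And>x y z. \<lbrakk>x \<in> carrier L; y \<in> carrier M; z \<in> carrier N\<rbrakk> \<Longrightarrow>
      f (pure R LM N (pure R L M x y) z) = g (pure R LM N (pure R L M x y) z)"
    and t: "t \<in> carrier T3"
  shows "f t = g t"
proof (rule tensor_eqI[OF tensor_mods(1) mods(3) f g _ t])
  fix u z assume u: "u \<in> carrier LM" and z: "z \<in> carrier N"
  have p: "linear_map R LM T3 (\<lambda>u. pure R LM N u z)"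
    by (rule bilinear_map_left[OF pure_is_bilinear[OF tensor_mods(1) mods(3)] z])
  show "f (pure R LM N u z) = g (pure R LM N u z)"
    by (rule tensor_eqI[OF mods(1,2) linear_map_comp[OF p f] linear_map_comp[OF p g] _ u]) (simp add: eq z)
qed

lemma tensor_assoc_inner_bilinear:
  assumes z: "z \<in> carrier N"
  shows "bilinear_map R L M T3' (\<lambda>x y. pure R L MN x (pure R M N y z))"
  using bilinear_map_comp[OF pure_is_bilinear[OF mods(1) tensor_mods(2)] linear_map_id
      bilinear_map_left[OF pure_is_bilinear[OF mods(2,3)] z]] .

lemma tensor_assoc_outer_bilinear:
  "bilinear_map R LM N T3' (\<lambda>t z. tensor_lift R T3' (\<lambda>x y. pure R L MN x (pure R M N y z)) t)"
proof (rule bilinear_mapI)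
  fix z assume "z \<in> carrier N"
  then show "linear_map R LM T3' (\<lambda>t. tensor_lift R T3' (\<lambda>x y. pure R L MN x (pure R M N y z)) t)"
    by (intro lift_linear mods tensor_mods tensor_assoc_inner_bilinear)
next
  fix t assume t: "t \<in> carrier LM"
  show "linear_map R N T3' (\<lambda>z. tensor_lift R T3' (\<lambda>x y. pure R L MN x (pure R M N y z)) t)"
    by (rule two_modules.tensor_lift_param[OF two_modulesI[OF mods(1,2)] mods(3) tensor_mods(4) _ _ t])
      (auto intro: tensor_assoc_inner_bilinear
          linear_map_comp[OF bilinear_map_right[OF pure_is_bilinear[OF mods(2,3)]]]
         bilinear_map_right[OF pure_is_bilinear[OF mods(1) tensor_mods(2)]])
qed

lemma tensor_assoc_linear: "linear_map R T3 T3' (tensor_assoc R L M N)"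
  unfolding tensor_assoc_def by (intro lift_linear mods tensor_mods tensor_assoc_outer_bilinear)

lemma tensor_assoc_pure:
  assumes "x \<in> carrier L" "y \<in> carrier M" "z \<in> carrier N"
  shows "tensor_assoc R L M N (pure R LM N (pure R L M x y) z) = pure R L MN x (pure R M N y z)"
  unfolding tensor_assoc_def
  by (subst lift_pure[OF tensor_mods(1) mods(3) tensor_mods(4) tensor_assoc_outer_bilinear])
    (simp_all add: assms lift_pure[OF mods(1,2) tensor_mods(4) tensor_assoc_inner_bilinear]
        pure_in_tensor[OF mods(1,2)])

end

lemma three_modulesI: "\<lbrakk>module R L; module R M; module R N\<rbrakk> \<Longrightarrow> three_modules R L M N"
  by (simp add: three_modules_def)

text \<open>Both sides are linear in \<open>t\<close> and agree on threefold pure tensors.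
  Naturality is what carries coassociativity to quotients, where the associator upstairs has to be
  exchanged for the one downstairs.\<close>

lemma tensor_assoc_natural:
  assumes m: "module R L" "module R M" "module R N" "module R L'" "module R M'" "module R N'"
    and l: "linear_map R L L' f" "linear_map R M M' g" "linear_map R N N' h"
    and t: "t \<in> carrier (tensor R (tensor R L M) N)"
  shows "tensor_assoc R L' M' N' (tensor_map R (tensor R L' M') N' (tensor_map R L' M' f g) h t) =
    tensor_map R L' (tensor R M' N') f (tensor_map R M' N' g h) (tensor_assoc R L M N t)"
proof -
  interpret three_modules R L M N by (intro three_modulesI m)
  interpret X: three_modules R L' M' N' by (intro three_modulesI m)
  note fg = tensor_map_is_linear[OF m(1,2,4,5) l(1,2)] and gh = tensor_map_is_linear[OF m(2,3,5,6) l(2,3)]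
  note fgh = tensor_map_is_linear[OF tensor_mods(1) m(3) X.tensor_mods(1) m(6) fg l(3)]
  note fgh' = tensor_map_is_linear[OF m(1) tensor_mods(2) m(4) X.tensor_mods(2) l(1) gh]
  show ?thesis
    by (rule tensor3_ext[OF X.tensor_mods(4) linear_map_comp[OF fgh X.tensor_assoc_linear]
          linear_map_comp[OF tensor_assoc_linear fgh'] _ t])
      (simp add: tensor_map_of_pure[OF tensor_mods(1) m(3) X.tensor_mods(1) m(6) fg l(3)]
        tensor_map_of_pure[OF m(1) tensor_mods(2) m(4) X.tensor_mods(2) l(1) gh]
        tensor_map_of_pure[OF m(1,2,4,5) l(1,2)] tensor_map_of_pure[OF m(2,3,5,6) l(2,3)]
        tensor_assoc_pure X.tensor_assoc_pure pure_in_tensor m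
        linear_map_closed[OF l(1)] linear_map_closed[OF l(2)] linear_map_closed[OF l(3)])
qed

section \<open>The tensor product of two algebras\<close>

lemma (in abelian_monoid) finsum_cartesian_product:
  assumes "finite A" "finite B" "\<And>a b. \<lbrakk>a \<in> A; b \<in> B\<rbrakk> \<Longrightarrow> f (a, b) \<in> carrier G"
  shows "(\<Oplus>s\<in>A \<times> B. f s) = (\<Oplus>a\<in>A. \<Oplus>b\<in>B. f (a, b))"
  using assms(1,3)
proof (induction A rule: finite_induct)
  case (insert a A)
  have eq: "insert a A \<times> B = Pair a ` B \<union> A \<times> B" by auto
  have "(\<Oplus>s\<in>insert a A \<times> B. f s) = (\<Oplus>s\<in>Pair a ` B. f s) \<oplus> (\<Oplus>s\<in>A \<times> B. f s)"
    unfolding eq using insert assms(2) by (intro finsum_Un_disjoint) auto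
  also have "(\<Oplus>s\<in>Pair a ` B. f s) = (\<Oplus>b\<in>B. f (a, b))"
    using insert by (intro finsum_reindex) (auto simp: inj_on_def)
  finally show ?case
    using insert by (simp add: Pi_def)
qed simp

locale two_algebras = M: assoc_algebra R M + N: assoc_algebra R N
  for R (structure) and M (structure) and N (structure)
begin

sublocale two_modules R M N by (intro two_modulesI M.module_axioms N.module_axioms)

abbreviation pr where "pr x y x' y' \<equiv> pure R M N (x \<otimes>\<^bsub>M\<^esub> x') (y \<otimes>\<^bsub>N\<^esub> y')"

text \<open>
  The library's product of cosets is a union over representatives. \<open>tmul\<close> gives the same product
  through the universal property, where well-definedness and bilinearity are automatic.
\<close>

definition tmul where "tmul s t = tensor_lift R T (\<lambda>x y. tensor_lift R T (pr x y) t) s"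

lemma mult_linear:
  "x \<in> carrier M \<Longrightarrow> linear_map R M M (\<lambda>x'. x \<otimes>\<^bsub>M\<^esub> x')"
  "x \<in> carrier M \<Longrightarrow> linear_map R M M (\<lambda>x'. x' \<otimes>\<^bsub>M\<^esub> x)"
  "y \<in> carrier N \<Longrightarrow> linear_map R N N (\<lambda>y'. y \<otimes>\<^bsub>N\<^esub> y')"
  "y \<in> carrier N \<Longrightarrow> linear_map R N N (\<lambda>y'. y' \<otimes>\<^bsub>N\<^esub> y)"
  by (auto intro!: linear_mapI simp: M.r_distr M.l_distr N.r_distr N.l_distr M.smult_mult_left
      N.smult_mult_left
      M.smult_mult_right N.smult_mult_right)

lemma pr_bilinear: "\<lbrakk>x \<in> carrier M; y \<in> carrier N\<rbrakk> \<Longrightarrow> bilinear_map R M N T (pr x y)"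
  by (intro bilinear_map_pure_comp mult_linear M.module_axioms N.module_axioms)

lemma pr_bilinear': "\<lbrakk>x' \<in> carrier M; y' \<in> carrier N\<rbrakk> \<Longrightarrow> bilinear_map R M N T (\<lambda>x y. pr x y x' y')"
  by (intro bilinear_map_pure_comp mult_linear M.module_axioms N.module_axioms)

lemma tmul_outer_bilinear:
  assumes t: "t \<in> carrier T"
  shows "bilinear_map R M N T (\<lambda>x y. tensor_lift R T (pr x y) t)"
proof (rule bilinear_mapI; rule tensor_lift_param[OF _ tensor_module _ _ t])
qed (auto intro: pr_bilinear bilinear_map_left[OF pr_bilinear'] bilinear_map_right[OF pr_bilinear']
    M.module_axioms N.module_axioms)

lemma tmul_bilinear: "bilinear_map R T T T tmul"
proof (rule bilinear_mapI)
  fix t assume t: "t \<in> carrier T"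
  show "linear_map R T T (\<lambda>s. tmul s t)"
    unfolding tmul_def by (intro tensor_lift_linear tensor_module tmul_outer_bilinear t)
  show "linear_map R T T (\<lambda>s. tmul t s)"
    unfolding tmul_def
    by (rule tensor_lift_param[OF tensor_module tensor_module _ _ t])
      (auto intro: tmul_outer_bilinear tensor_lift_linear tensor_module pr_bilinear)
qed

lemma tmul_pure:
  "\<lbrakk>x \<in> carrier M; y \<in> carrier N; x' \<in> carrier M; y' \<in> carrier N\<rbrakk> \<Longrightarrow>
    tmul (pure R M N x y) (pure R M N x' y') = pure R M N (x \<otimes>\<^bsub>M\<^esub> x') (y \<otimes>\<^bsub>N\<^esub> y')"
  unfolding tmul_def
  by (simp add: tensor_lift_pure[OF tensor_module tmul_outer_bilinear] tensor_lift_pure[OF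
      tensor_module pr_bilinear]
     pure_closed)

text \<open>At a pair \<open>p\<close> the right side keeps exactly the terms whose product pair is
  \<open>p\<close>, which is the index set of the monoid ring product. In the form of a linear
  combination the product can be passed through the class map.\<close>

lemma free_mult:
  assumes f: "f \<in> carrier F" and g: "g \<in> carrier F"
  defines "A \<equiv> {p. f p \<noteq> \<zero>}" and "B \<equiv> {p. g p \<noteq> \<zero>}"
  shows "f \<otimes>\<^bsub>F\<^esub> g = (\<Oplus>\<^bsub>F\<^esub>s\<in>A \<times> B. (f (fst s) \<otimes> g (snd s)) \<odot>\<^bsub>F\<^esub>
      single R (fst (fst s) \<otimes>\<^bsub>M\<^esub> fst (snd s), snd (fst s) \<otimes>\<^bsub>N\<^esub> snd (snd s)))"
proof
  fix p
  let ?m = "\<lambda>s. (fst (fst s) \<otimes>\<^bsub>M\<^esub> fst (snd s), snd (fst s) \<otimes>\<^bsub>N\<^esub> snd (snd s))"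
  let ?c = "\<lambda>s. f (fst s) \<otimes> g (snd s)"
  have c: "?c s \<in> carrier R" for s
    using free_on_pairs_apply[OF f] free_on_pairs_apply[OF g] by simp
  have fin: "finite A" "finite B" and sub: "A \<subseteq> carrier M \<times> carrier N" "B \<subseteq> carrier M \<times> carrier N"
    using free_on_pairs_finite[OF f] free_on_pairs_support[OF f]
      free_on_pairs_finite[OF g] free_on_pairs_support[OF g] by (auto simp: A_def B_def)
  have "(\<Oplus>\<^bsub>F\<^esub>s\<in>A \<times> B. ?c s \<odot>\<^bsub>F\<^esub> single R (?m s)) p = (\<Oplus>s\<in>A \<times> B. (?c s \<odot>\<^bsub>F\<^esub> single R (?m s)) p)"
    using fin sub c by (intro finsum_free_on_pairs_apply R_cring)
        (auto intro!: F.smult_closed single_closed R_cring M.A.m_closed N.A.m_closed)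
  also have "\<dots> = (\<Oplus>s\<in>{s \<in> A \<times> B. ?m s = p}. ?c s)"
    using fin c
    by (intro M.R.add.finprod_mono_neutral_cong_right) (auto simp: free_on_pairs_simps(4) single_def)
  also have "{s \<in> A \<times> B. ?m s = p} = {(q, r). f q \<noteq> \<zero> \<and> g r \<noteq> \<zero> \<and>
               (fst q \<otimes>\<^bsub>M\<^esub> fst r, snd q \<otimes>\<^bsub>N\<^esub> snd r) = p}"
    by (auto simp: A_def B_def)
  finally show "(f \<otimes>\<^bsub>F\<^esub> g) p = (\<Oplus>\<^bsub>F\<^esub>s\<in>A \<times> B. ?c s \<odot>\<^bsub>F\<^esub> single R (?m s)) p"
    by (simp add: free_on_pairs_def)
qed

text \<open>The finite double sum is regrouped: the inner sum is the inner lift of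
  \<open>tmul\<close> at the class of \<open>g\<close>, the outer sum is the outer lift at the class
  of \<open>f\<close>. As the right side sees only classes, the product of formal sums respects the
  relations.\<close>

lemma class_mult:
  assumes f: "f \<in> carrier F" and g: "g \<in> carrier F"
  shows "K +>\<^bsub>F\<^esub> (f \<otimes>\<^bsub>F\<^esub> g) = tmul (K +>\<^bsub>F\<^esub> f) (K +>\<^bsub>F\<^esub> g)"
proof -
  define A B where "A = {p. f p \<noteq> \<zero>}" and "B = {p. g p \<noteq> \<zero>}"
  have c: "f p \<in> carrier R" "g p \<in> carrier R" for p
    using free_on_pairs_apply[OF f] free_on_pairs_apply[OF g] by simp_all
  have fin: "finite A" "finite B" and sub: "A \<subseteq> carrier M \<times> carrier N" "B \<subseteq> carrier M \<times> carrier N"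
    using free_on_pairs_finite[OF f] free_on_pairs_support[OF f]
      free_on_pairs_finite[OF g] free_on_pairs_support[OF g] by (auto simp: A_def B_def)
  let ?m = "\<lambda>s. (fst (fst s) \<otimes>\<^bsub>M\<^esub> fst (snd s), snd (fst s) \<otimes>\<^bsub>N\<^esub> snd (snd s))"
  let ?p = "\<lambda>q r. pr (fst q) (snd q) (fst r) (snd r)"
  have p: "?p q r \<in> carrier T" if "q \<in> A" "r \<in> B" for q r
    using that sub by (auto intro!: pure_closed M.A.m_closed N.A.m_closed)
  have "K +>\<^bsub>F\<^esub> (f \<otimes>\<^bsub>F\<^esub> g) = (\<Oplus>\<^bsub>T\<^esub>s\<in>A \<times> B. K +>\<^bsub>F\<^esub> ((f (fst s) \<otimes> g (snd s)) \<odot>\<^bsub>F\<^esub> single R (?m s)))"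
    unfolding free_mult[OF f g] A_def[symmetric] B_def[symmetric] using fin sub c
    by (intro linear_map_finsum[OF F.module_axioms tensor_module class_linear])
      (auto intro!: F.smult_closed single_closed R_cring M.A.m_closed N.A.m_closed)
  also have "\<dots> = (\<Oplus>\<^bsub>T\<^esub>s\<in>A \<times> B. f (fst s) \<odot>\<^bsub>T\<^esub> (g (snd s) \<odot>\<^bsub>T\<^esub> ?p (fst s) (snd s)))"
  proof (rule T.finsum_cong')
    fix s assume s: "s \<in> A \<times> B"
    then have "single R (?m s) \<in> carrier F" using sub by
        (auto intro!: single_closed R_cring M.A.m_closed N.A.m_closed)
    then have "K +>\<^bsub>F\<^esub> ((f (fst s) \<otimes> g (snd s)) \<odot>\<^bsub>F\<^esub> single R (?m s)) =
      (f (fst s) \<otimes> g (snd s)) \<odot>\<^bsub>T\<^esub> ?p (fst s) (snd s)"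
      using c by (simp add: linear_map_smult[OF class_linear] pure_def)
    then show "K +>\<^bsub>F\<^esub> ((f (fst s) \<otimes> g (snd s)) \<odot>\<^bsub>F\<^esub> single R (?m s)) =
      f (fst s) \<odot>\<^bsub>T\<^esub> (g (snd s) \<odot>\<^bsub>T\<^esub> ?p (fst s) (snd s))"
      using c s p by (auto simp: T.smult_assoc1)
  qed (use c p in auto)
  also have "\<dots> = (\<Oplus>\<^bsub>T\<^esub>q\<in>A. \<Oplus>\<^bsub>T\<^esub>r\<in>B. f q \<odot>\<^bsub>T\<^esub> (g r \<odot>\<^bsub>T\<^esub> ?p q r))"
    using fin c p by (subst T.finsum_cartesian_product) auto
  also have "\<dots> = (\<Oplus>\<^bsub>T\<^esub>q\<in>A. f q \<odot>\<^bsub>T\<^esub> (\<Oplus>\<^bsub>T\<^esub>r\<in>B. g r \<odot>\<^bsub>T\<^esub> ?p q r))"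
    using fin c p by (intro T.finsum_cong') (auto simp: T.finsum_smult_ldistr intro!: T.finsum_closed)
  also have "\<dots> = (\<Oplus>\<^bsub>T\<^esub>q\<in>A. f q \<odot>\<^bsub>T\<^esub> tensor_lift R T (pr (fst q) (snd q)) (K +>\<^bsub>F\<^esub> g))"
  proof (rule T.finsum_cong'[OF refl])
    fix q assume "q \<in> A"
    then have q: "fst q \<in> carrier M" "snd q \<in> carrier N" using sub by auto
    show "f q \<odot>\<^bsub>T\<^esub> (\<Oplus>\<^bsub>T\<^esub>r\<in>B. g r \<odot>\<^bsub>T\<^esub> ?p q r) = f q \<odot>\<^bsub>T\<^esub> tensor_lift R T (pr (fst q) (snd q)) (K +>\<^bsub>F\<^esub> g)"
      by (simp add: tensor_lift_class[OF tensor_module pr_bilinear[OF q] g] formal_sum_eval_def B_def)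
  qed (use sub c in \<open>auto intro!: T.smult_closed linear_map_closed[OF tensor_lift_linear[OF
      tensor_module pr_bilinear]]
        linear_map_closed[OF class_linear] g\<close>)
  also have "\<dots> = tmul (K +>\<^bsub>F\<^esub> f) (K +>\<^bsub>F\<^esub> g)"
    unfolding tmul_def
    by (simp add: tensor_lift_class[OF tensor_module tmul_outer_bilinear f]
        linear_map_closed[OF class_linear g]
        formal_sum_eval_def A_def)
  finally show ?thesis .
qed

text \<open>The product of cosets is a union over representatives, all of whose members agree by
  \<open>class_mult\<close>. This takes the place of showing that \<open>K\<close> is a two-sided
  ideal.\<close>

lemma tensor_mult_eq_tmul:
  assumes "s \<in> carrier T" "t \<in> carrier T"
  shows "s \<otimes>\<^bsub>T\<^esub> t = tmul s t"
proof -
  interpret K: abelian_subgroup K F by (rule F.submodule_abelian_subgroup[OF kernel_submodule])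
  obtain f g where f: "f \<in> carrier F" "s = K +>\<^bsub>F\<^esub> f" and g: "g \<in> carrier F" "t = K +>\<^bsub>F\<^esub> g"
    using assms F.quotient_carrier[OF kernel_submodule] by (auto simp: tensor_eq)
  have *: "a \<in> carrier F \<and> K +>\<^bsub>F\<^esub> a = K +>\<^bsub>F\<^esub> h" if "h \<in> carrier F" "a \<in> K +>\<^bsub>F\<^esub> h" for a h
    using that K.a_elemrcos_carrier K.a_repr_independence' by metis
  have "K +>\<^bsub>F\<^esub> (a \<otimes>\<^bsub>F\<^esub> b) = tmul s t" if "a \<in> s" "b \<in> t" for a b
    using that *[OF f(1), of a] *[OF g(1), of b] f g class_mult[of a b] by simp
  then have "(\<Union>a\<in>s. \<Union>b\<in>t. K +>\<^bsub>F\<^esub> (a \<otimes>\<^bsub>F\<^esub> b)) = tmul s t"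
    using K.a_rcos_self[OF f(1)] K.a_rcos_self[OF g(1)] f(2) g(2) by blast
  then show ?thesis
    by (simp add: tensor_eq quotient_algebra_def FactRing_def rcoset_mult_def)
qed

lemma tensor_one: "\<one>\<^bsub>T\<^esub> = pure R M N \<one>\<^bsub>M\<^esub> \<one>\<^bsub>N\<^esub>"
  by (simp add: tensor_eq quotient_algebra_def FactRing_def pure_def) (simp add: free_on_pairs_def)

lemma tensor_mult_closed: "\<lbrakk>s \<in> carrier T; t \<in> carrier T\<rbrakk> \<Longrightarrow> s \<otimes>\<^bsub>T\<^esub> t \<in> carrier T"
  using bilinear_map_closed[OF tmul_bilinear] by (simp add: tensor_mult_eq_tmul)

lemma tensor_mult_pure:
  "\<lbrakk>x \<in> carrier M; y \<in> carrier N; x' \<in> carrier M; y' \<in> carrier N\<rbrakk> \<Longrightarrow>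
    pure R M N x y \<otimes>\<^bsub>T\<^esub> pure R M N x' y' = pure R M N (x \<otimes>\<^bsub>M\<^esub> x') (y \<otimes>\<^bsub>N\<^esub> y')"
  by (simp add: tensor_mult_eq_tmul pure_closed tmul_pure)

lemma tensor_l_distr:
  "\<lbrakk>s \<in> carrier T; t \<in> carrier T; u \<in> carrier T\<rbrakk> \<Longrightarrow>
     (s \<oplus>\<^bsub>T\<^esub> t) \<otimes>\<^bsub>T\<^esub> u = s \<otimes>\<^bsub>T\<^esub> u \<oplus>\<^bsub>T\<^esub> t \<otimes>\<^bsub>T\<^esub> u"
  using linear_map_add[OF bilinear_map_left[OF tmul_bilinear]] by (simp add: tensor_mult_eq_tmul)

lemma tensor_r_distr:
  "\<lbrakk>s \<in> carrier T; t \<in> carrier T; u \<in> carrier T\<rbrakk> \<Longrightarrow>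
     u \<otimes>\<^bsub>T\<^esub> (s \<oplus>\<^bsub>T\<^esub> t) = u \<otimes>\<^bsub>T\<^esub> s \<oplus>\<^bsub>T\<^esub> u \<otimes>\<^bsub>T\<^esub> t"
  using linear_map_add[OF bilinear_map_right[OF tmul_bilinear]] by (simp add: tensor_mult_eq_tmul)

lemma tensor_m_assoc:
  assumes "s \<in> carrier T" "t \<in> carrier T" "u \<in> carrier T"
  shows "(s \<otimes>\<^bsub>T\<^esub> t) \<otimes>\<^bsub>T\<^esub> u = s \<otimes>\<^bsub>T\<^esub> (t \<otimes>\<^bsub>T\<^esub> u)"
  using assms(1)
proof (induction rule: tensor_induct)
  case (pure x y)
  note xy = this
  show ?case using assms(2)
  proof (induction rule: tensor_induct)
    case (pure x' y')
    note xy' = this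
    show ?case using assms(3)
    proof (induction rule: tensor_induct)
      case (pure x'' y'')
      then show ?case using xy xy' by (simp add: tensor_mult_pure M.m_assoc N.m_assoc)
    next
      case (add s t)
      then show ?case using xy xy' by (simp add: tensor_r_distr tensor_mult_closed pure_closed)
    qed
  next
    case (add s t)
    then show ?case using xy assms(3) by (simp add: tensor_r_distr tensor_l_distr
        tensor_mult_closed pure_closed)
  qed
next
  case (add s t)
  then show ?case using assms(2,3) by (simp add: tensor_l_distr tensor_mult_closed)
qed

lemma tensor_ring: "ring T"
proof (rule ringI)
  show "abelian_group T" ..
  show "monoid T"
  proof (rule monoidI)
    fix t assume t: "t \<in> carrier T"
    show "\<one>\<^bsub>T\<^esub> \<otimes>\<^bsub>T\<^esub> t = t" "t \<otimes>\<^bsub>T\<^esub> \<one>\<^bsub>T\<^esub> = t"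
      using t by (induction rule: tensor_induct)
        (simp_all add: tensor_one tensor_mult_pure tensor_l_distr tensor_r_distr pure_closed)
  qed (auto simp: tensor_mult_closed tensor_m_assoc tensor_one pure_closed)
qed (auto simp: tensor_l_distr tensor_r_distr)

end

lemma two_algebrasI: "\<lbrakk>assoc_algebra R M; assoc_algebra R N\<rbrakk> \<Longrightarrow> two_algebras R M N"
  by (simp add: two_algebras_def)

lemma assoc_algebra_module: "assoc_algebra R A \<Longrightarrow> module R A"
  by (simp add: assoc_algebra_def)

text \<open>Multiplicativity is an identity additive in \<open>s\<close> and in \<open>t\<close>,
  hence reduces to pure tensors by two inductions. It makes
  \<open>(\<pi> \<otimes> \<pi>) \<circ> \<Delta>\<close> and
  \<open>(id \<otimes> \<pi>) \<circ> \<Delta>\<close> multiplicative.\<close>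

lemma tensor_map_ring_hom:
  assumes a: "assoc_algebra R M" "assoc_algebra R N" "assoc_algebra R M'" "assoc_algebra R N'"
    and l: "linear_map R M M' f" "linear_map R N N' g"
    and h: "f \<in> ring_hom M M'" "g \<in> ring_hom N N'"
  shows "tensor_map R M' N' f g \<in> ring_hom (tensor R M N) (tensor R M' N')"
proof -
  interpret S: two_algebras R M N by (intro two_algebrasI a)
  interpret X: two_algebras R M' N' by (intro two_algebrasI a)
  note m = a[THEN assoc_algebra_module]
  note lin = tensor_map_is_linear[OF m l] and pure = tensor_map_of_pure[OF m l]
  note simps = pure S.tensor_mult_pure X.tensor_mult_pure linear_map_add[OF lin] linear_map_closed[OF lin]
    linear_map_closed[OF l(1)] linear_map_closed[OF l(2)] ring_hom_mult[OF h(1)] ring_hom_mult[OF h(2)]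
    S.tensor_l_distr S.tensor_r_distr X.tensor_l_distr X.tensor_r_distr S.tensor_mult_closed
        S.pure_closed X.pure_closed
  let ?f = "tensor_map R M' N' f g"
  show ?thesis
  proof (rule ring_hom_memI)
    fix s t assume s: "s \<in> carrier S.T" and t: "t \<in> carrier S.T"
    show "?f s \<in> carrier X.T" using s by (rule linear_map_closed[OF lin])
    show "?f (s \<oplus>\<^bsub>S.T\<^esub> t) = ?f s \<oplus>\<^bsub>X.T\<^esub> ?f t" using s t by (rule linear_map_add[OF lin])
    show "?f (s \<otimes>\<^bsub>S.T\<^esub> t) = ?f s \<otimes>\<^bsub>X.T\<^esub> ?f t"
      using s
    proof (induction rule: S.tensor_induct)
      case (pure x y)
      note xy = this
      show ?case using t
        by (induction rule: S.tensor_induct) (use xy in \<open>simp_all add: simps\<close>)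
    qed (use t in \<open>simp_all add: simps\<close>)
  next
    show "?f \<one>\<^bsub>S.T\<^esub> = \<one>\<^bsub>X.T\<^esub>"
      by (simp add: S.tensor_one X.tensor_one pure ring_hom_one[OF h(1)] ring_hom_one[OF h(2)])
  qed
qed

section \<open>Quotient algebras\<close>

text \<open>The equation \<open>h (p x) = g x\<close> already contains the well-definedness of
  \<open>h\<close>; surjectivity of \<open>p\<close> transports the laws from \<open>B\<close> to
  \<open>H\<close>.\<close>

lemma linear_map_factor:
  assumes "linear_map R B H p" "p ` carrier B = carrier H" "linear_map R B P g"
    and "\<And>x. x \<in> carrier B \<Longrightarrow> h (p x) = g x" and "module R B"
  shows "linear_map R H P h"
proof -
  interpret module R B by fact
  note p = linear_map_add[OF assms(1), symmetric] linear_map_smult[OF assms(1), symmetric]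
  have ex: "\<exists>b\<in>carrier B. x = p b" if "x \<in> carrier H" for x
    using that assms(2) by auto
  show ?thesis
    by (rule linear_mapI)
      (auto dest!: ex simp: p assms(4) linear_map_closed[OF assms(3)] linear_map_add[OF assms(3)]
        linear_map_smult[OF assms(3)])
qed

lemma ring_hom_factor:
  assumes "ring B" and p: "p \<in> ring_hom B H" "p ` carrier B = carrier H" and g: "g \<in> ring_hom B P"
    and "\<And>x. x \<in> carrier B \<Longrightarrow> h (p x) = g x"
  shows "h \<in> ring_hom H P"
proof -
  interpret ring B by fact
  have ex: "\<exists>b\<in>carrier B. x = p b" if "x \<in> carrier H" for x
    using that p(2) by auto
  show ?thesis
  proof (rule ring_hom_memI)
    show "h \<one>\<^bsub>H\<^esub> = \<one>\<^bsub>P\<^esub>"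
      using assms(5)[of "\<one>\<^bsub>B\<^esub>"] ring_hom_one[OF p(1)] ring_hom_one[OF g] by simp
  qed (auto dest!: ex simp: assms(5) ring_hom_closed[OF g] ring_hom_mult[OF p(1), symmetric]
      ring_hom_mult[OF g]
      ring_hom_add[OF p(1), symmetric] ring_hom_add[OF g])
qed

lemma regular_module_simps:
  "carrier (regular_module R) = carrier R" "add (regular_module R) = add R"
  "zero (regular_module R) = zero R" "smult (regular_module R) = mult R"
  by (simp_all add: regular_module_def)

lemma regular_module_module:
  assumes "cring R"
  shows "module R (regular_module R)"
proof -
  interpret cring R by fact
  show ?thesis
  proof (rule moduleI)
    show "abelian_group (regular_module R)"
      by (rule abelian_groupI) (auto simp: regular_module_simps a_ac intro: l_neg)
  qed (auto simp: regular_module_simps l_distr r_distr m_assoc cring_axioms)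
qed

text \<open>Both argument orders occur because the two counit axioms put the scalar on opposite
  sides.\<close>

lemma (in module) smult_bilinear:
  "bilinear_map R M (regular_module R) M (\<lambda>x a. a \<odot>\<^bsub>M\<^esub> x)"
  "bilinear_map R (regular_module R) M M (\<lambda>a x. a \<odot>\<^bsub>M\<^esub> x)"
proof -
  have "a \<odot>\<^bsub>M\<^esub> (b \<odot>\<^bsub>M\<^esub> x) = b \<odot>\<^bsub>M\<^esub> (a \<odot>\<^bsub>M\<^esub> x)" if "a \<in> carrier R" "b \<in> carrier R" "x \<in> carrier M" for a b x
    using that smult_assoc1 R.m_comm by metis
  then have 1: "linear_map R M M (\<lambda>x. a \<odot>\<^bsub>M\<^esub> x)" if "a \<in> carrier R" for a
    using that by (intro linear_mapI) (auto simp: smult_r_distr)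
  have 2: "linear_map R (regular_module R) M (\<lambda>a. a \<odot>\<^bsub>M\<^esub> x)" if "x \<in> carrier M" for x
    using that by (intro linear_mapI) (auto simp: regular_module_simps smult_l_distr smult_assoc1)
  show "bilinear_map R M (regular_module R) M (\<lambda>x a. a \<odot>\<^bsub>M\<^esub> x)"
    "bilinear_map R (regular_module R) M M (\<lambda>a x. a \<odot>\<^bsub>M\<^esub> x)"
    by (auto intro!: bilinear_mapI 1 2 simp: regular_module_simps)
qed

section \<open>Quotients of algebras by ideals\<close>

context assoc_algebra
begin

lemma mult_bilinear: "bilinear_map R A A A (\<lambda>x y. x \<otimes>\<^bsub>A\<^esub> y)"
  by (intro bilinear_mapI linear_mapI)
    (auto simp: A.l_distr A.r_distr smult_mult_left smult_mult_right)

text \<open>A ring ideal absorbs scalars because \<open>a x = (a 1) x\<close>.\<close>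

lemma ideal_submodule:
  assumes "ideal I A"
  shows "submodule I R A"
proof -
  interpret ideal I A by fact
  show ?thesis
  proof (rule submoduleI)
    fix a x assume a: "a \<in> carrier R" and x: "x \<in> I"
    then have "a \<odot>\<^bsub>A\<^esub> x = (a \<odot>\<^bsub>A\<^esub> \<one>\<^bsub>A\<^esub>) \<otimes>\<^bsub>A\<^esub> x"
      using a_subset by (subst smult_mult_left) auto
    also have "\<dots> \<in> I" using a x by (intro I_l_closed) auto
    finally show "a \<odot>\<^bsub>A\<^esub> x \<in> I" .
  qed (use a_subset in auto)
qed

context
  fixes I
  assumes I: "ideal I A"
begin

interpretation I: ideal I A by (rule I)

lemma quotient_mult:
  "\<lbrakk>x \<in> carrier A; y \<in> carrier A\<rbrakk> \<Longrightarrow>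
     (I +>\<^bsub>A\<^esub> x) \<otimes>\<^bsub>quotient_algebra A I\<^esub> (I +>\<^bsub>A\<^esub> y) = I +>\<^bsub>A\<^esub> (x \<otimes>\<^bsub>A\<^esub> y)"
  by (simp add: quotient_algebra_def FactRing_def I.rcoset_mult_add)

lemma quotient_one: "\<one>\<^bsub>quotient_algebra A I\<^esub> = I +>\<^bsub>A\<^esub> \<one>\<^bsub>A\<^esub>"
  by (simp add: quotient_algebra_def FactRing_def)

lemma quotient_assoc_algebra: "assoc_algebra R (quotient_algebra A I)"
proof -
  let ?Q = "quotient_algebra A I"
  note S = ideal_submodule[OF I]
  note simps = quotient_carrier[OF S] quotient_mult quotient_add[OF S] quotient_one quotient_smult[OF S]
  interpret Q: module R ?Q by (rule quotient_module[OF S])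
  have "ring ?Q"
  proof (rule ringI)
    show "abelian_group ?Q" ..
    show "monoid ?Q"
      by (rule monoidI) (auto simp: simps A.m_assoc)
  qed (auto simp: simps A.l_distr A.r_distr)
  moreover have "assoc_algebra_axioms R ?Q"
    by unfold_locales (auto simp: simps smult_mult_left smult_mult_right)
  ultimately show ?thesis
    by (simp add: assoc_algebra_def Q.module_axioms)
qed

lemma quotient_proj_ring_hom: "(\<lambda>x. I +>\<^bsub>A\<^esub> x) \<in> ring_hom A (quotient_algebra A I)"
  by (rule ring_hom_memI)
    (auto simp: quotient_carrier[OF ideal_submodule[OF I]] quotient_mult quotient_add[OF
        ideal_submodule[OF I]] quotient_one)

end

end

section \<open>Convolution\<close>

context bialgebra
begin

lemma B_module: "module R B" ..

definition conv where
  "conv f g x = tensor_lift R B (\<lambda>y z. f y \<otimes>\<^bsub>B\<^esub> g z) (\<Delta> x)"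

definition conv_unit where
  "conv_unit x = \<epsilon> x \<odot>\<^bsub>B\<^esub> \<one>\<^bsub>B\<^esub>"

abbreviation endo where "endo f \<equiv> linear_map R B B f"

lemma comult_closed: "x \<in> carrier B \<Longrightarrow> \<Delta> x \<in> carrier (tensor R B B)"
  by (rule linear_map_closed[OF comult_linear])

lemma conv_bilinear: "\<lbrakk>endo f; endo g\<rbrakk> \<Longrightarrow> bilinear_map R B B B (\<lambda>y z. f y \<otimes>\<^bsub>B\<^esub> g z)"
  by (rule bilinear_map_comp[OF mult_bilinear])

lemma conv_lift_linear:
  "\<lbrakk>endo f; endo g\<rbrakk> \<Longrightarrow> linear_map R (tensor R B B) B (tensor_lift R B (\<lambda>y z. f y \<otimes>\<^bsub>B\<^esub> g z))"
  by (intro lift_linear B_module conv_bilinear)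

lemma conv_linear: "\<lbrakk>endo f; endo g\<rbrakk> \<Longrightarrow> endo (conv f g)"
  unfolding conv_def using linear_map_comp[OF comult_linear conv_lift_linear] by blast

lemma conv_cong:
  assumes "endo f" "endo g" "\<And>x. x \<in> carrier B \<Longrightarrow> f' x = f x" "\<And>x. x \<in> carrier B \<Longrightarrow> g' x = g x"
    and "x \<in> carrier B"
  shows "conv f' g' x = conv f g x"
  unfolding conv_def using assms
  by (intro two_modules.tensor_lift_cong[OF two_modulesI[OF B_module B_module] B_module]
      conv_bilinear comult_closed)
    (auto intro: linear_map_eq B_module)

lemma conv_unit_linear: "endo conv_unit"
  using linear_map_comp[OF counit_linear bilinear_map_left[OF smult_bilinear(2) A.one_closed]]
  unfolding conv_unit_def[abs_def] .

text \<open>Pulling the scalar out gives \<open>f(y) \<epsilon>(z) 1 = f(\<epsilon>(z) y)\<close>;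
  then \<open>f\<close> moves out of the lift and the right counit axiom remains.\<close>

lemma conv_unit_right:
  assumes f: "endo f" and x: "x \<in> carrier B"
  shows "conv f conv_unit x = f x"
proof -
  have b: "bilinear_map R B B B (\<lambda>y z. \<epsilon> z \<odot>\<^bsub>B\<^esub> y)"
    using bilinear_map_comp[OF smult_bilinear(1) linear_map_id counit_linear] .
  note \<epsilon> = linear_map_closed[OF counit_linear, unfolded regular_module_simps]
  have "conv f conv_unit x = tensor_lift R B (\<lambda>y z. f (\<epsilon> z \<odot>\<^bsub>B\<^esub> y)) (\<Delta> x)"
    unfolding conv_def
    by (intro two_modules.tensor_lift_cong[OF two_modulesI[OF B_module B_module] B_module] conv_bilinear f
        conv_unit_linear bilinear_map_post[OF b f] comult_closed x)
      (simp add: conv_unit_def \<epsilon> smult_mult_right linear_map_closed[OF f] linear_map_smult[OF f])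
  also have "\<dots> = f x"
    using two_modules.tensor_lift_post[OF two_modulesI[OF B_module B_module] B_module B_module b f
        comult_closed[OF x]]
    by (simp add: counit_right x)
  finally show ?thesis .
qed

lemma conv_unit_left:
  assumes f: "endo f" and x: "x \<in> carrier B"
  shows "conv conv_unit f x = f x"
proof -
  have b: "bilinear_map R B B B (\<lambda>y z. \<epsilon> y \<odot>\<^bsub>B\<^esub> z)"
    using bilinear_map_comp[OF smult_bilinear(2) counit_linear linear_map_id] .
  note \<epsilon> = linear_map_closed[OF counit_linear, unfolded regular_module_simps]
  have "conv conv_unit f x = tensor_lift R B (\<lambda>y z. f (\<epsilon> y \<odot>\<^bsub>B\<^esub> z)) (\<Delta> x)"
    unfolding conv_def
    by (intro two_modules.tensor_lift_cong[OF two_modulesI[OF B_module B_module] B_module] conv_bilinear f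
        conv_unit_linear bilinear_map_post[OF b f] comult_closed x)
      (simp add: conv_unit_def \<epsilon> smult_mult_left linear_map_closed[OF f] linear_map_smult[OF f])
  also have "\<dots> = f x"
    using two_modules.tensor_lift_post[OF two_modulesI[OF B_module B_module] B_module B_module b f
        comult_closed[OF x]]
    by (simp add: counit_left x)
  finally show ?thesis .
qed

text \<open>Each side is a lift of the threefold product \<open>f(u) g(v) h(w)\<close>, evaluated at
  one of the two iterated coproducts of \<open>x\<close>. Associativity of the multiplication
  identifies the lifts across the associator, coassociativity identifies the arguments.\<close>

lemma conv_assoc:
  assumes f: "endo f" and g: "endo g" and h: "endo h" and x: "x \<in> carrier B"
  shows "conv (conv f g) h x = conv f (conv g h) x"
proof -
  interpret three_modules R B B B by (intro three_modulesI B_module)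
  let ?m = "\<lambda>f g. tensor_lift R B (\<lambda>y z. f y \<otimes>\<^bsub>B\<^esub> g z)"
  have b1: "bilinear_map R LM B B (\<lambda>t z. ?m f g t \<otimes>\<^bsub>B\<^esub> h z)"
    by (rule bilinear_map_comp[OF mult_bilinear conv_lift_linear[OF f g] h])
  have b2: "bilinear_map R B MN B (\<lambda>y t. f y \<otimes>\<^bsub>B\<^esub> ?m g h t)"
    by (rule bilinear_map_comp[OF mult_bilinear f conv_lift_linear[OF g h]])
  have t: "tensor_map R LM B \<Delta> (\<lambda>y. y) (\<Delta> x) \<in> carrier T3"
    by (rule linear_map_closed[OF tensor_map_is_linear[OF B_module B_module
        tensor_mods(1) B_module comult_linear
          linear_map_id] comult_closed[OF x]])
  have "conv (conv f g) h x = tensor_lift R B (\<lambda>t z. ?m f g t \<otimes>\<^bsub>B\<^esub> h z) (tensor_map R LM B \<Delta> (\<lambda>y. y) (\<Delta> x))"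
    unfolding conv_def
    by (rule lift_tensor_map[OF B_module B_module tensor_mods(1) B_module comult_linear
        linear_map_id B_module b1
          comult_closed[OF x], symmetric])
  also have "\<dots> = tensor_lift R B (\<lambda>y t. f y \<otimes>\<^bsub>B\<^esub> ?m g h t) (tensor_assoc R B B B (tensor_map R LM B
      \<Delta> (\<lambda>y. y) (\<Delta> x)))"
  proof (rule tensor3_ext[OF B_module lift_linear[OF tensor_mods(1) B_module B_module b1]
        linear_map_comp[OF tensor_assoc_linear lift_linear[OF B_module tensor_mods(2) B_module b2]] _ t])
    fix u v w assume "u \<in> carrier B" "v \<in> carrier B" "w \<in> carrier B"
    then show "tensor_lift R B (\<lambda>t z. ?m f g t \<otimes>\<^bsub>B\<^esub> h z) (pure R LM B (pure R B B u v) w) =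
        tensor_lift R B (\<lambda>y t. f y \<otimes>\<^bsub>B\<^esub> ?m g h t) (tensor_assoc R B B B (pure R LM B (pure R B B u v) w))"
      by (simp add: tensor_assoc_pure pure_in_tensor B_module lift_pure[OF
          tensor_mods(1) B_module B_module b1]
          lift_pure[OF B_module tensor_mods(2) B_module b2]
              lift_pure[OF B_module B_module B_module conv_bilinear[OF f g]]
          lift_pure[OF B_module B_module B_module conv_bilinear[OF g h]] A.m_assoc
          linear_map_closed[OF f] linear_map_closed[OF g] linear_map_closed[OF h])
  qed
  also have "\<dots> = tensor_lift R B (\<lambda>y t. f y \<otimes>\<^bsub>B\<^esub> ?m g h t) (tensor_map R B MN (\<lambda>y. y) \<Delta> (\<Delta> x))"
    by (simp add: coassoc x)
  also have "\<dots> = conv f (conv g h) x"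
    unfolding conv_def
    by (rule lift_tensor_map[OF B_module B_module B_module tensor_mods(2)
        linear_map_id comult_linear B_module b2
          comult_closed[OF x]])
  finally show ?thesis .
qed

lemma conv_add_left:
  assumes "endo f" "endo f'" "endo g" "x \<in> carrier B"
  shows "conv (\<lambda>x. f x \<oplus>\<^bsub>B\<^esub> f' x) g x = conv f g x \<oplus>\<^bsub>B\<^esub> conv f' g x"
proof -
  note fg = conv_lift_linear[OF assms(1,3)] and fg' = conv_lift_linear[OF assms(2,3)]
  note pl = linear_map_plus[OF B_module assms(1,2)]
  show ?thesis unfolding conv_def
    by (rule tensor_eqI[OF B_module B_module conv_lift_linear[OF pl assms(3)]
        linear_map_plus[OF B_module fg fg'] _ comult_closed[OF assms(4)]])
      (simp add: lift_pure[OF B_module B_module B_module conv_bilinear] assms pl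
          linear_map_closed[OF assms(1)]
        linear_map_closed[OF assms(2)] linear_map_closed[OF assms(3)] A.l_distr)
qed

lemma conv_add_right:
  assumes "endo f" "endo f'" "endo g" "x \<in> carrier B"
  shows "conv g (\<lambda>x. f x \<oplus>\<^bsub>B\<^esub> f' x) x = conv g f x \<oplus>\<^bsub>B\<^esub> conv g f' x"
proof -
  note fg = conv_lift_linear[OF assms(3,1)] and fg' = conv_lift_linear[OF assms(3,2)]
  note pl = linear_map_plus[OF B_module assms(1,2)]
  show ?thesis unfolding conv_def
    by (rule tensor_eqI[OF B_module B_module conv_lift_linear[OF assms(3) pl]
        linear_map_plus[OF B_module fg fg'] _ comult_closed[OF assms(4)]])
      (simp add: lift_pure[OF B_module B_module B_module conv_bilinear] assms pl
          linear_map_closed[OF assms(1)]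
        linear_map_closed[OF assms(2)] linear_map_closed[OF assms(3)] A.r_distr)
qed

end

section \<open>The geometric series for the antipode\<close>

context bialgebra
begin

text \<open>The overview's \<open>P\<close>. The difference is written with the scalar
  \<open>-1\<close>, so that linearity is an instance of closure of linear maps under sums and
  multiples.\<close>

definition unit_minus_id where
  "unit_minus_id x = conv_unit x \<oplus>\<^bsub>B\<^esub> (\<ominus> \<one>) \<odot>\<^bsub>B\<^esub> x"

primrec conv_power where
  "conv_power f 0 = conv_unit"
| "conv_power f (Suc n) = conv f (conv_power f n)"

lemma unit_minus_id_linear: "endo unit_minus_id"
  unfolding unit_minus_id_def[abs_def]
  by (intro linear_map_plus linear_map_smult_fun B_module conv_unit_linear linear_map_id) simp

lemma conv_power_linear: "endo f \<Longrightarrow> endo (conv_power f n)"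
  by (induction n) (auto intro: conv_unit_linear conv_linear)

text \<open>Powers grow by a factor on the left; a two-sided inverse of the identity also needs the
  factor on the right.\<close>

lemma conv_power_commute:
  assumes f: "endo f" and x: "x \<in> carrier B"
  shows "conv (conv_power f n) f x = conv f (conv_power f n) x"
  using x
proof (induction n arbitrary: x)
  case 0
  then show ?case using f by (simp add: conv_unit_left conv_unit_right)
next
  case (Suc n)
  note l = conv_power_linear[OF f, of n]
  have "conv (conv_power f (Suc n)) f x = conv f (conv (conv_power f n) f) x"
    using conv_assoc[OF f l f Suc.prems] by simp
  also have "\<dots> = conv f (conv f (conv_power f n)) x"
    by (rule conv_cong[OF f conv_linear[OF f l] refl Suc.IH Suc.prems])
  finally show ?case by simp
qed

text \<open>Cut off at a fixed \<open>k\<close>, the geometric series is visibly linear, whereas in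
  the full series the cut-off varies with the element.\<close>

definition partial_antipode where
  "partial_antipode k x = (\<Oplus>\<^bsub>B\<^esub>m\<in>{..<k}. conv_power unit_minus_id m x)"

lemma partial_antipode_linear: "endo (partial_antipode k)"
  unfolding partial_antipode_def[abs_def]
  by (intro linear_map_finsum_fun B_module conv_power_linear unit_minus_id_linear) simp

lemma partial_antipode_Suc:
  assumes "x \<in> carrier B"
  shows "partial_antipode (Suc k) x = partial_antipode k x \<oplus>\<^bsub>B\<^esub> conv_power unit_minus_id k x"
  using assms linear_map_closed[OF conv_power_linear[OF unit_minus_id_linear]]
  unfolding partial_antipode_def lessThan_Suc by (subst M.finsum_insert) (auto simp: M.add.m_comm)

text \<open>The identity is \<open>conv_unit\<close> minus \<open>P\<close>, so convolving it with
  \<open>P^k\<close> on either side gives \<open>P^k\<close> minus its successor. This is one step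
  of the telescoping sum, written without subtraction.\<close>

lemma conv_power_split:
  assumes x: "x \<in> carrier B"
  shows "conv (conv_power unit_minus_id k) (\<lambda>x. x) x \<oplus>\<^bsub>B\<^esub> conv_power unit_minus_id (Suc k) x
      = conv_power unit_minus_id k x"
    and "conv (\<lambda>x. x) (conv_power unit_minus_id k) x \<oplus>\<^bsub>B\<^esub> conv_power unit_minus_id (Suc k) x
        = conv_power unit_minus_id k x"
proof -
  let ?P = unit_minus_id
  note l = conv_power_linear[OF unit_minus_id_linear, of k]
  have P: "y \<oplus>\<^bsub>B\<^esub> ?P y = conv_unit y" if "y \<in> carrier B" for y
    using that linear_map_closed[OF conv_unit_linear, of y]
    by (simp add: unit_minus_id_def smult_minus_one M.add.m_lcomm[of y "conv_unit y"] M.r_neg)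
  have u: "conv (conv_power ?P k) (\<lambda>y. y \<oplus>\<^bsub>B\<^esub> ?P y) x = conv_power ?P k x"
    "conv (\<lambda>y. y \<oplus>\<^bsub>B\<^esub> ?P y) (conv_power ?P k) x = conv_power ?P k x"
    using conv_cong[OF l conv_unit_linear refl P x] conv_cong[OF conv_unit_linear l P refl x]
    by (simp_all add: conv_unit_left conv_unit_right l x)
  show "conv (conv_power ?P k) (\<lambda>x. x) x \<oplus>\<^bsub>B\<^esub> conv_power ?P (Suc k) x = conv_power ?P k x"
    using conv_add_right[OF linear_map_id unit_minus_id_linear l x] u(1)
      conv_power_commute[OF unit_minus_id_linear x] by simp
  show "conv (\<lambda>x. x) (conv_power ?P k) x \<oplus>\<^bsub>B\<^esub> conv_power ?P (Suc k) x = conv_power ?P k x"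
    using conv_add_left[OF linear_map_id unit_minus_id_linear l x] u(2) by simp
qed

text \<open>The telescoping sum: the truncated series inverts the identity up to the error term
  \<open>P^k\<close>, which disappears wherever \<open>P^k\<close> vanishes.\<close>

lemma conv_partial_antipode:
  assumes x: "x \<in> carrier B"
  shows "conv (partial_antipode k) (\<lambda>x. x) x \<oplus>\<^bsub>B\<^esub> conv_power unit_minus_id k x = conv_unit x \<and>
    conv (\<lambda>x. x) (partial_antipode k) x \<oplus>\<^bsub>B\<^esub> conv_power unit_minus_id k x = conv_unit x"
proof (induction k)
  note s = partial_antipode_linear
  case 0
  have z: "partial_antipode 0 = (\<lambda>_. \<zero>\<^bsub>B\<^esub>)" by (simp add: partial_antipode_def fun_eq_iff)
  \<comment> \<open>By additivity, convolution with the zero map equals twice itself, hence is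
    zero.\<close>
  have "conv (partial_antipode 0) (\<lambda>x. x) x = \<zero>\<^bsub>B\<^esub>" "conv (\<lambda>x. x) (partial_antipode 0) x = \<zero>\<^bsub>B\<^esub>"
    using conv_add_left[OF s[of 0] s[of 0] linear_map_id x] conv_add_right[OF s[of 0] s[of 0]
        linear_map_id x]
      linear_map_closed[OF conv_linear[OF s[of 0] linear_map_id] x]
          linear_map_closed[OF conv_linear[OF linear_map_id s[of 0]] x]
    unfolding z by simp_all
  then show ?case using linear_map_closed[OF conv_unit_linear x] by simp
next
  let ?p = "conv_power unit_minus_id"
  note l = conv_power_linear[OF unit_minus_id_linear] and s = partial_antipode_linear
  case (Suc k)
  note c = linear_map_closed[OF l[of k] x] linear_map_closed[OF l[of "Suc k"] x]
    linear_map_closed[OF conv_linear[OF s[of k] linear_map_id] x]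
    linear_map_closed[OF conv_linear[OF linear_map_id s[of k]] x]
    linear_map_closed[OF conv_linear[OF l[of k] linear_map_id] x]
    linear_map_closed[OF conv_linear[OF linear_map_id l[of k]] x]
  have "conv (partial_antipode (Suc k)) (\<lambda>x. x) x = conv (partial_antipode k) (\<lambda>x. x) x
      \<oplus>\<^bsub>B\<^esub> conv (?p k) (\<lambda>x. x) x"
    using conv_cong[OF linear_map_plus[OF B_module s l] linear_map_id partial_antipode_Suc refl x]
      conv_add_left[OF s l linear_map_id x] by simp
  moreover have "conv (\<lambda>x. x) (partial_antipode (Suc k)) x = conv (\<lambda>x. x) (partial_antipode k) x
      \<oplus>\<^bsub>B\<^esub> conv (\<lambda>x. x) (?p k) x"
    using conv_cong[OF linear_map_id linear_map_plus[OF B_module s l] refl partial_antipode_Suc x]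
      conv_add_right[OF s l linear_map_id x] by simp
  ultimately show ?case
    using Suc conv_power_split[OF x, of k] c by (simp add: M.add.m_assoc del: conv_power.simps)
qed

text \<open>The antipode is the limit of the truncations, which become constant at each element.
  Constancy at \<open>x\<close> gives no control over the factors of \<open>\<Delta> x\<close>;
  therefore \<open>S\<close> is compared with truncations on whole tensors.\<close>

lemma hopf_algebra_if_locally_nilpotent:
  assumes nil: "\<And>x. x \<in> carrier B \<Longrightarrow> \<exists>n. \<forall>m\<ge>n. conv_power unit_minus_id m x = \<zero>\<^bsub>B\<^esub>"
  shows "hopf_algebra R B \<Delta> \<epsilon>"
proof -
  let ?p = "conv_power unit_minus_id"
  note l = conv_power_linear[OF unit_minus_id_linear] and s = partial_antipode_linear
  obtain N where N: "\<And>x m. \<lbrakk>x \<in> carrier B; N x \<le> m\<rbrakk> \<Longrightarrow> ?p m x = \<zero>\<^bsub>B\<^esub>"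
    using nil by metis
  define S where "S x = partial_antipode (N x) x" for x
  \<comment> \<open>From \<open>N x\<close> onwards every added term vanishes, so any longer
    truncation also computes \<open>S x\<close>; this freedom permits the common truncations
    below.\<close>
  have S: "S x = partial_antipode k x" if "x \<in> carrier B" "N x \<le> k" for x k
    using that(2)
  proof (induction k rule: dec_induct)
    case (step k)
    then show ?case
      using that(1) N[OF that(1), of k] linear_map_closed[OF s that(1)] by (simp add: partial_antipode_Suc)
  qed (simp add: S_def)
  have S_lin: "endo S"
  proof (rule linear_mapI)
    fix x assume x: "x \<in> carrier B"
    show "S x \<in> carrier B" unfolding S_def by (rule linear_map_closed[OF s x])
    fix y assume y: "y \<in> carrier B"
    \<comment> \<open>A truncation valid at all three elements turns additivity of \<open>S\<close>
      into that of a linear map.\<close>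
    let ?k = "max (N (x \<oplus>\<^bsub>B\<^esub> y)) (max (N x) (N y))"
    show "S (x \<oplus>\<^bsub>B\<^esub> y) = S x \<oplus>\<^bsub>B\<^esub> S y"
      using x y S[of _ ?k] linear_map_add[OF s x y, of ?k] by simp
  next
    fix a x assume a: "a \<in> carrier R" and x: "x \<in> carrier B"
    let ?k = "max (N (a \<odot>\<^bsub>B\<^esub> x)) (N x)"
    show "S (a \<odot>\<^bsub>B\<^esub> x) = a \<odot>\<^bsub>B\<^esub> S x"
      using x a S[of _ ?k] linear_map_smult[OF s a x, of ?k] by simp
  qed
  let ?m = "\<lambda>f g. tensor_lift R B (\<lambda>y z. f y \<otimes>\<^bsub>B\<^esub> g z)"
  \<comment> \<open>Agreement for all large \<open>k\<close>, rather than for some \<open>k\<close>,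
    is stable under sums of tensors by taking maxima, so it can be proved by induction; the bound
    depends on the tensor.\<close>
  have ev: "\<exists>k0. \<forall>k\<ge>k0. ?m S (\<lambda>x. x) t = ?m (partial_antipode k) (\<lambda>x. x) t \<and>
      ?m (\<lambda>x. x) S t = ?m (\<lambda>x. x) (partial_antipode k) t" if "t \<in> carrier (tensor R B B)" for t
    using that
  proof (induction rule: two_modules.tensor_induct[OF two_modulesI[OF B_module B_module], consumes
      1, case_names pure add])
    case (pure x y)
    show ?case
    proof (intro exI[of _ "max (N x) (N y)"] allI impI)
      fix k assume "max (N x) (N y) \<le> k"
      then have "S x = partial_antipode k x" "S y = partial_antipode k y"
        using pure by (auto intro: S)
      with pure show "?m S (\<lambda>x. x) (pure R B B x y) = ?m (partial_antipode k) (\<lambda>x. x) (pure R B B x y) \<and>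
          ?m (\<lambda>x. x) S (pure R B B x y) = ?m (\<lambda>x. x) (partial_antipode k) (pure R B B x y)"
        by (simp add: lift_pure[OF B_module B_module B_module conv_bilinear] S_lin s linear_map_id)
    qed
  next
    case (add t u)
    then obtain k1 k2 where
      k1: "\<forall>k\<ge>k1. ?m S (\<lambda>x. x) t = ?m (partial_antipode k) (\<lambda>x. x) t \<and>
        ?m (\<lambda>x. x) S t = ?m (\<lambda>x. x) (partial_antipode k) t" and
      k2: "\<forall>k\<ge>k2. ?m S (\<lambda>x. x) u = ?m (partial_antipode k) (\<lambda>x. x) u \<and>
        ?m (\<lambda>x. x) S u = ?m (\<lambda>x. x) (partial_antipode k) u"
      by blast
    show ?case
    proof (intro exI[of _ "max k1 k2"] allI impI)
      fix k assume "max k1 k2 \<le> k"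
      then show "?m S (\<lambda>x. x) (t \<oplus>\<^bsub>tensor R B B\<^esub> u) = ?m (partial_antipode k) (\<lambda>x. x) (t
          \<oplus>\<^bsub>tensor R B B\<^esub> u) \<and>
          ?m (\<lambda>x. x) S (t \<oplus>\<^bsub>tensor R B B\<^esub> u) = ?m (\<lambda>x. x) (partial_antipode k) (t \<oplus>\<^bsub>tensor R B B\<^esub> u)"
        using add(1,2) k1[rule_format, of k] k2[rule_format, of k]
        by (simp add: linear_map_add[OF conv_lift_linear[OF S_lin linear_map_id]]
            linear_map_add[OF conv_lift_linear[OF s linear_map_id]]
            linear_map_add[OF conv_lift_linear[OF linear_map_id S_lin]]
            linear_map_add[OF conv_lift_linear[OF linear_map_id s]])
    qed
  qed
  have "conv S (\<lambda>x. x) x = conv_unit x \<and> conv (\<lambda>x. x) S x = conv_unit x" if x: "x \<in> carrier B" for x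
  proof -
    obtain k0 where k0: "\<forall>k\<ge>k0. conv S (\<lambda>x. x) x = conv (partial_antipode k) (\<lambda>x. x) x \<and>
      conv (\<lambda>x. x) S x = conv (\<lambda>x. x) (partial_antipode k) x"
      using ev[OF comult_closed[OF x]] unfolding conv_def by blast
    \<comment> \<open>The bound \<open>k0\<close> lets a truncation replace \<open>S\<close> on the
      factors of \<open>\<Delta> x\<close>, and \<open>N x\<close> makes the error term at
      \<open>x\<close> vanish.\<close>
    let ?k = "max k0 (N x)"
    show ?thesis
      using k0[rule_format, of ?k] N[OF x, of ?k] conv_partial_antipode[OF x, of ?k]
        linear_map_closed[OF conv_linear[OF s linear_map_id] x] linear_map_closed[OF conv_linear[OF
            linear_map_id s] x]
      by simp
  qed
  then show ?thesis
    using S_lin unfolding conv_def conv_unit_def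
    by (intro hopf_algebra.intro hopf_algebra_axioms.intro bialgebra_axioms) blast
qed

end

section \<open>Quotients of bialgebras\<close>

text \<open>The map \<open>f\<close> is kept apart from \<open>p\<close> to cover two uses:
  \<open>f = p\<close> gives coassociativity of the quotient, \<open>f = id\<close> the coaction
  axiom. In both, \<open>f \<otimes> p \<otimes> p\<close> is moved past the associator by
  naturality and coassociativity of \<open>C\<close> is applied underneath.\<close>

lemma coalgebra_quotient_coassoc:
  assumes C: "coalgebra R C \<Delta> \<epsilon>" and mods: "module R A" "module R H"
    and f: "linear_map R C A f" and p: "linear_map R C H p"
    and \<rho>: "linear_map R A (tensor R A H) \<rho>" and D: "linear_map R H (tensor R H H) D"
    and \<rho>f: "\<And>x. x \<in> carrier C \<Longrightarrow> \<rho> (f x) = tensor_map R A H f p (\<Delta> x)"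
    and Dp: "\<And>x. x \<in> carrier C \<Longrightarrow> D (p x) = tensor_map R H H p p (\<Delta> x)"
    and x: "x \<in> carrier C"
  shows "tensor_assoc R A H H (tensor_map R (tensor R A H) H \<rho> (\<lambda>h. h) (\<rho> (f x))) =
    tensor_map R A (tensor R H H) (\<lambda>y. y) D (\<rho> (f x))"
proof -
  interpret C: coalgebra R C \<Delta> \<epsilon> by fact
  have Cm: "module R C" ..
  note tm = tensor_is_module
  have CC: "module R (tensor R C C)" and AH: "module R (tensor R A H)" and HH: "module R (tensor R H H)"
    by (intro tm Cm mods)+
  have fp: "linear_map R (tensor R C C) (tensor R A H) (tensor_map R A H f p)"
    and pp: "linear_map R (tensor R C C) (tensor R H H) (tensor_map R H H p p)"
    by (intro tensor_map_is_linear Cm mods f p)+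
  have \<Delta>x: "\<Delta> x \<in> carrier (tensor R C C)" by (rule linear_map_closed[OF C.comult_linear x])
  have t: "tensor_map R (tensor R C C) C \<Delta> (\<lambda>y. y) (\<Delta> x) \<in> carrier (tensor R (tensor R C C) C)"
    by (rule linear_map_closed[OF tensor_map_is_linear[OF Cm Cm CC Cm C.comult_linear linear_map_id] \<Delta>x])
  have "tensor_map R (tensor R A H) H \<rho> (\<lambda>h. h) (\<rho> (f x)) =
      tensor_map R (tensor R A H) H (\<lambda>y. \<rho> (f y)) p (\<Delta> x)"
    unfolding \<rho>f[OF x]
    by (rule tensor_map_comp[OF Cm Cm mods AH mods(2) f p \<rho> linear_map_id \<Delta>x])
  also have "\<dots> = tensor_map R (tensor R A H) H (\<lambda>y. tensor_map R A H f p (\<Delta> y)) p (\<Delta> x)"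
    by (rule tensor_map_cong[OF Cm Cm AH mods(2) linear_map_comp[OF f \<rho>] p \<rho>f refl \<Delta>x])
  also have "\<dots> = tensor_map R (tensor R A H) H (tensor_map R A H f p) p (tensor_map R (tensor R C C)
      C \<Delta> (\<lambda>y. y) (\<Delta> x))"
    by (rule tensor_map_comp[OF Cm Cm CC Cm AH mods(2) C.comult_linear linear_map_id fp p \<Delta>x, symmetric])
  finally have "tensor_assoc R A H H (tensor_map R (tensor R A H) H \<rho> (\<lambda>h. h) (\<rho> (f x))) =
      tensor_map R A (tensor R H H) f (tensor_map R H H p p)
        (tensor_assoc R C C C (tensor_map R (tensor R C C) C \<Delta> (\<lambda>y. y) (\<Delta> x)))"
    by (simp add: tensor_assoc_natural[OF Cm Cm Cm mods mods(2) f p p t])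
  also have "\<dots> = tensor_map R A (tensor R H H) f (tensor_map R H H p p) (tensor_map R C (tensor R C
      C) (\<lambda>y. y) \<Delta> (\<Delta> x))"
    by (simp add: C.coassoc x)
  also have "\<dots> = tensor_map R A (tensor R H H) f (\<lambda>y. tensor_map R H H p p (\<Delta> y)) (\<Delta> x)"
    by (rule tensor_map_comp[OF Cm Cm Cm CC mods(1) HH linear_map_id C.comult_linear f pp \<Delta>x])
  also have "\<dots> = tensor_map R A (tensor R H H) f (\<lambda>y. D (p y)) (\<Delta> x)"
    by (rule tensor_map_cong[OF Cm Cm mods(1) HH f
        linear_map_comp[OF C.comult_linear pp] refl Dp[symmetric] \<Delta>x])
  also have "\<dots> = tensor_map R A (tensor R H H) (\<lambda>y. y) D (tensor_map R A H f p (\<Delta> x))"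
    by (rule tensor_map_comp[OF Cm Cm mods mods(1) HH f p linear_map_id D \<Delta>x, symmetric])
  finally show ?thesis by (simp add: \<rho>f x)
qed

text \<open>Since \<open>e \<circ> p = \<epsilon>\<close>, each left side is \<open>f\<close>
  applied to the left side of a counit axiom of \<open>C\<close>. The case \<open>f = p\<close>
  serves the quotient coalgebra; the first equation with \<open>f = id\<close> serves the
  coaction.\<close>

lemma coalgebra_quotient_counit:
  assumes C: "coalgebra R C \<Delta> \<epsilon>" and mods: "module R A" "module R H"
    and f: "linear_map R C A f" and p: "linear_map R C H p"
    and e: "linear_map R H (regular_module R) e"
    and ep: "\<And>x. x \<in> carrier C \<Longrightarrow> e (p x) = \<epsilon> x"
    and x: "x \<in> carrier C"
  shows "tensor_lift R A (\<lambda>y h. e h \<odot>\<^bsub>A\<^esub> y) (tensor_map R A H f p (\<Delta> x)) = f x"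
    and "tensor_lift R A (\<lambda>h y. e h \<odot>\<^bsub>A\<^esub> y) (tensor_map R H A p f (\<Delta> x)) = f x"
proof -
  interpret C: coalgebra R C \<Delta> \<epsilon> by fact
  interpret A: module R A by fact
  have Cm: "module R C" ..
  have \<Delta>x: "\<Delta> x \<in> carrier (tensor R C C)" by (rule linear_map_closed[OF C.comult_linear x])
  note \<epsilon> = linear_map_closed[OF C.counit_linear, unfolded regular_module_simps]
  note cong = two_modules.tensor_lift_cong[OF two_modulesI[OF Cm Cm] mods(1)]
  note post = two_modules.tensor_lift_post[OF two_modulesI[OF Cm Cm] Cm mods(1) _ f \<Delta>x]
  have b: "bilinear_map R A H A (\<lambda>y h. e h \<odot>\<^bsub>A\<^esub> y)" "bilinear_map R C C C (\<lambda>y z. \<epsilon> z \<odot>\<^bsub>C\<^esub> y)"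
    "bilinear_map R H A A (\<lambda>h y. e h \<odot>\<^bsub>A\<^esub> y)" "bilinear_map R C C C (\<lambda>y z. \<epsilon> y \<odot>\<^bsub>C\<^esub> z)"
    using bilinear_map_comp[OF A.smult_bilinear(1) linear_map_id e]
      bilinear_map_comp[OF C.smult_bilinear(1) linear_map_id C.counit_linear]
      bilinear_map_comp[OF A.smult_bilinear(2) e linear_map_id]
      bilinear_map_comp[OF C.smult_bilinear(2) C.counit_linear linear_map_id] .
  have "tensor_lift R A (\<lambda>y h. e h \<odot>\<^bsub>A\<^esub> y) (tensor_map R A H f p (\<Delta> x)) =
      tensor_lift R A (\<lambda>y z. e (p z) \<odot>\<^bsub>A\<^esub> f y) (\<Delta> x)"
    by (rule lift_tensor_map[OF Cm Cm mods f p mods(1) b(1) \<Delta>x])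
  also have "\<dots> = tensor_lift R A (\<lambda>y z. f (\<epsilon> z \<odot>\<^bsub>C\<^esub> y)) (\<Delta> x)"
    by (rule cong[OF bilinear_map_comp[OF b(1) f p] bilinear_map_post[OF b(2) f] _ \<Delta>x])
      (simp add: ep linear_map_smult[OF f] \<epsilon>)
  finally show "tensor_lift R A (\<lambda>y h. e h \<odot>\<^bsub>A\<^esub> y) (tensor_map R A H f p (\<Delta> x)) = f x"
    by (simp add: post[OF b(2), symmetric] C.counit_right x)
  have "tensor_lift R A (\<lambda>h y. e h \<odot>\<^bsub>A\<^esub> y) (tensor_map R H A p f (\<Delta> x)) =
      tensor_lift R A (\<lambda>y z. e (p y) \<odot>\<^bsub>A\<^esub> f z) (\<Delta> x)"
    by (rule lift_tensor_map[OF Cm Cm mods(2,1) p f mods(1) b(3) \<Delta>x])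
  also have "\<dots> = tensor_lift R A (\<lambda>y z. f (\<epsilon> y \<odot>\<^bsub>C\<^esub> z)) (\<Delta> x)"
    by (rule cong[OF bilinear_map_comp[OF b(3) p f] bilinear_map_post[OF b(4) f] _ \<Delta>x])
      (simp add: ep linear_map_smult[OF f] \<epsilon>)
  finally show "tensor_lift R A (\<lambda>h y. e h \<odot>\<^bsub>A\<^esub> y) (tensor_map R H A p f (\<Delta> x)) = f x"
    by (simp add: post[OF b(4), symmetric] C.counit_left x)
qed

text \<open>A surjection of bialgebras, given by the equations that \<open>D\<close> and
  \<open>e\<close> satisfy on values of \<open>p\<close>. That the concrete \<open>D\<close> and
  \<open>e\<close> satisfy them is left to the instance, where it amounts to vanishing on
  \<open>I\<close>.\<close>

locale bialgebra_quotient = B: bialgebra R B \<Delta> \<epsilon> + H: assoc_algebra R H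
  for R (structure) and B (structure) and \<Delta> and \<epsilon> and H (structure) +
  fixes p and D and e
  assumes p_linear: "linear_map R B H p" and p_hom: "p \<in> ring_hom B H"
    and p_surj: "p ` carrier B = carrier H"
    and D_p: "x \<in> carrier B \<Longrightarrow> D (p x) = tensor_map R H H p p (\<Delta> x)"
    and e_p: "x \<in> carrier B \<Longrightarrow> e (p x) = \<epsilon> x"
begin

lemma mods: "module R B" "module R H" ..

lemma algs: "assoc_algebra R B" "assoc_algebra R H" ..

lemma D_linear: "linear_map R H (tensor R H H) D"
  by (rule linear_map_factor[OF p_linear p_surj linear_map_comp[OF B.comult_linear
          tensor_map_is_linear[OF mods(1) mods(1) mods(2) mods(2) p_linear p_linear]] D_p mods(1)])

lemma e_linear: "linear_map R H (regular_module R) e"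
  by (rule linear_map_factor[OF p_linear p_surj B.counit_linear e_p mods(1)])

lemma H_coalgebra: "coalgebra R H D e"
proof -
  have C: "coalgebra R B \<Delta> \<epsilon>" ..
  have ex: "\<exists>b\<in>carrier B. x = p b" if "x \<in> carrier H" for x
    using that p_surj by auto
  have "coalgebra_axioms R H D e"
  proof
    fix x assume "x \<in> carrier H"
    then obtain b where b: "b \<in> carrier B" "x = p b" using ex by auto
    show "tensor_assoc R H H H (tensor_map R (tensor R H H) H D (\<lambda>y. y) (D x)) =
        tensor_map R H (tensor R H H) (\<lambda>y. y) D (D x)"
      unfolding b(2)
      by (rule coalgebra_quotient_coassoc[OF C mods(2) mods(2) p_linear p_linear D_linear D_linear
          D_p D_p b(1)])
    show "tensor_lift R H (\<lambda>y z. e y \<odot>\<^bsub>H\<^esub> z) (D x) = x" "tensor_lift R H (\<lambda>y z. e z \<odot>\<^bsub>H\<^esub> y) (D x) = x"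
      unfolding b(2) D_p[OF b(1)]
      by (rule coalgebra_quotient_counit[OF C mods(2) mods(2) p_linear p_linear e_linear e_p b(1)];
          assumption)+
  qed (rule D_linear e_linear)+
  then show ?thesis by (simp add: coalgebra_def mods)
qed

lemma H_bialgebra: "bialgebra R H D e"
proof -
  have B: "ring B" ..
  have "D \<in> ring_hom H (tensor R H H)"
    by (rule ring_hom_factor[OF B p_hom p_surj ring_hom_trans[OF B.comult_hom
            tensor_map_ring_hom[OF algs(1,1,2,2) p_linear p_linear p_hom p_hom]]])
      (simp add: D_p)
  moreover have "e \<in> ring_hom H R"
    by (rule ring_hom_factor[OF B p_hom p_surj B.counit_hom e_p])
  ultimately show ?thesis
    by (simp add: bialgebra_def bialgebra_axioms_def algs H_coalgebra)
qed

sublocale H: bialgebra R H D e by (rule H_bialgebra)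

text \<open>Convolution in the quotient is computed from \<open>\<Delta> x\<close> in
  \<open>B\<close>, which is where the quasi-filtration gives information.\<close>

lemma conv_p:
  assumes "linear_map R H H f" "linear_map R H H g" "x \<in> carrier B"
  shows "H.conv f g (p x) = tensor_lift R H (\<lambda>y z. f (p y) \<otimes>\<^bsub>H\<^esub> g (p z)) (\<Delta> x)"
  unfolding H.conv_def D_p[OF assms(3)]
  by (rule lift_tensor_map[OF mods(1) mods(1) mods(2) mods(2) p_linear p_linear mods(2)
      H.conv_bilinear[OF assms(1,2)]
        B.comult_closed[OF assms(3)]])

lemma quotient_hopf_coaction:
  assumes "hopf_algebra R H D e"
  shows "hopf_coaction R H D e B (\<lambda>x. tensor_map R B H (\<lambda>y. y) p (\<Delta> x))"
proof -
  let ?\<rho> = "\<lambda>x. tensor_map R B H (\<lambda>y. y) p (\<Delta> x)"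
  have C: "coalgebra R B \<Delta> \<epsilon>" ..
  have \<rho>: "linear_map R B (tensor R B H) ?\<rho>"
    by (rule linear_map_comp[OF B.comult_linear
        tensor_map_is_linear[OF mods(1) mods(1) mods(1) mods(2) linear_map_id p_linear]])
  have "(\<lambda>y. y) \<in> ring_hom B B" by (rule ring_hom_memI) auto
  then have "tensor_map R B H (\<lambda>y. y) p \<circ> \<Delta> \<in> ring_hom B (tensor R B H)"
    by (intro ring_hom_trans[OF B.comult_hom] tensor_map_ring_hom algs linear_map_id p_linear p_hom)
  then have hom: "?\<rho> \<in> ring_hom B (tensor R B H)" by (simp add: comp_def)
  have "hopf_coaction_axioms R H D e B ?\<rho>"
    using \<rho> hom coalgebra_quotient_coassoc[OF C mods linear_map_id p_linear \<rho> D_linear refl D_p]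
      coalgebra_quotient_counit(1)[OF C mods linear_map_id p_linear e_linear e_p]
    by (simp add: hopf_coaction_axioms_def)
  then show ?thesis
    using assms algs(1) by (simp add: hopf_coaction_def)
qed

end

section \<open>The reduced Hopf algebra\<close>

lemma quasi_filtration_subset:
  assumes "module R C" "g \<in> carrier C"
  shows "quasi_filtration R C \<Delta> n g h \<subseteq> carrier C"
proof -
  interpret module R C by fact
  show ?thesis using assms(2) by (cases n) auto
qed

text \<open>The kernel is an ideal containing the generators, so minimality of the generated ideal
  applies. Both structure maps of the reduced bialgebra descend by this argument.\<close>

lemma ring_hom_zero_on_difference_ideal:
  assumes "ring A" "ring P" "f \<in> ring_hom A P" "G \<subseteq> carrier A"
    and const: "\<And>g h. \<lbrakk>g \<in> G; h \<in> G\<rbrakk> \<Longrightarrow> f g = f h"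
    and x: "x \<in> Idl\<^bsub>A\<^esub> {g \<ominus>\<^bsub>A\<^esub> h | g h. g \<in> G \<and> h \<in> G}"
  shows "f x = \<zero>\<^bsub>P\<^esub>"
proof -
  interpret ring_hom_ring A P f using assms(1-3) by (rule ring_hom_ringI2)
  have "g \<ominus>\<^bsub>A\<^esub> h \<in> a_kernel A P f" if "g \<in> G" "h \<in> G" for g h
  proof -
    have gh: "g \<in> carrier A" "h \<in> carrier A" using that assms(4) by blast+
    then have "f (g \<ominus>\<^bsub>A\<^esub> h) = f g \<ominus>\<^bsub>P\<^esub> f h"
      by (simp only: a_minus_def hom_add hom_a_inv R.a_inv_closed)
    also have "\<dots> = \<zero>\<^bsub>P\<^esub>"
      unfolding const[OF that] using gh by (simp add: a_minus_def S.r_neg)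
    finally show ?thesis using R.minus_closed[OF gh] by (simp only: a_kernel_def' mem_Collect_eq simp_thms)
  qed
  then have "{g \<ominus>\<^bsub>A\<^esub> h | g h. g \<in> G \<and> h \<in> G} \<subseteq> a_kernel A P f"
    by blast
  then have "x \<in> a_kernel A P f"
    by (rule subsetD[OF R.genideal_minimal[OF kernel_is_ideal] x])
  then show ?thesis by (simp only: a_kernel_def' mem_Collect_eq)
qed

locale grouplike_bialgebra = bialgebra R B \<Delta> \<epsilon>
  for R (structure) and B (structure) and \<Delta> and \<epsilon> +
  assumes grouplike: "semigrouplikes R B \<Delta> \<subseteq> grouplikes R B \<Delta> \<epsilon>"
begin

abbreviation I where "I \<equiv> reduction_ideal R B \<Delta> \<epsilon>"
abbreviation H where "H \<equiv> reduced_algebra R B \<Delta> \<epsilon>"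
abbreviation p where "p \<equiv> reduction R B \<Delta> \<epsilon>"
abbreviation D where "D \<equiv> reduced_comult R B \<Delta> \<epsilon>"
abbreviation e where "e \<equiv> reduced_counit R B \<Delta> \<epsilon>"

lemma grouplikeD:
  assumes "g \<in> grouplikes R B \<Delta> \<epsilon>"
  shows "g \<in> carrier B" "\<Delta> g = pure R B B g g" "\<epsilon> g = \<one>"
  using assms by (auto simp: grouplikes_def semigrouplikes_def)

lemma differences_closed:
  "{g \<ominus>\<^bsub>B\<^esub> h | g h. g \<in> grouplikes R B \<Delta> \<epsilon> \<and> h \<in> grouplikes R B \<Delta> \<epsilon>} \<subseteq> carrier B"
  using grouplikeD(1) by auto

lemma I_ideal: "ideal I B"
  unfolding reduction_ideal_def by (rule A.genideal_ideal[OF differences_closed])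

lemma I_submodule: "submodule I R B" by (rule ideal_submodule[OF I_ideal])

lemma H_algebra: "assoc_algebra R H"
  unfolding reduced_algebra_def by (rule quotient_assoc_algebra[OF I_ideal])

lemma p_linear: "linear_map R B H p"
  using quotient_proj_linear[OF I_submodule] unfolding reduced_algebra_def reduction_def[abs_def] .

lemma p_hom: "p \<in> ring_hom B H"
  using quotient_proj_ring_hom[OF I_ideal] unfolding reduced_algebra_def reduction_def[abs_def] .

lemma p_surj: "p ` carrier B = carrier H"
  using quotient_carrier[OF I_submodule] unfolding reduced_algebra_def reduction_def[abs_def] by simp

lemma p_grouplike_eq:
  assumes "g \<in> grouplikes R B \<Delta> \<epsilon>" "h \<in> grouplikes R B \<Delta> \<epsilon>"
  shows "p g = p h"
proof -
  have "g \<ominus>\<^bsub>B\<^esub> h \<in> I"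
    unfolding reduction_ideal_def using A.genideal_self[OF differences_closed] assms by blast
  then show ?thesis
    using assms[THEN grouplikeD(1)] by (simp add: reduction_def coset_eq_iff[OF I_submodule])
qed

text \<open>A grouplike \<open>g\<close> is sent to \<open>\<pi> g \<otimes> \<pi> g\<close>, the
  same tensor for all grouplikes because \<open>\<pi>\<close> identifies them.\<close>

lemma tensor_comult_vanish:
  assumes "x \<in> I"
  shows "tensor_map R H H p p (\<Delta> x) = \<zero>\<^bsub>tensor R H H\<^esub>"
proof -
  have B: "assoc_algebra R B" ..
  note Hm = assoc_algebra_module[OF H_algebra]
  interpret HH: two_algebras R H H by (intro two_algebrasI H_algebra)
  have hom: "tensor_map R H H p p \<circ> \<Delta> \<in> ring_hom B (tensor R H H)"
    by (intro ring_hom_trans[OF comult_hom] tensor_map_ring_hom B H_algebra p_linear p_hom)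
  have "(tensor_map R H H p p \<circ> \<Delta>) x = \<zero>\<^bsub>tensor R H H\<^esub>"
  proof (rule ring_hom_zero_on_difference_ideal[OF A.ring_axioms HH.tensor_ring hom])
    fix g h assume g: "g \<in> grouplikes R B \<Delta> \<epsilon>" and h: "h \<in> grouplikes R B \<Delta> \<epsilon>"
    show "(tensor_map R H H p p \<circ> \<Delta>) g = (tensor_map R H H p p \<circ> \<Delta>) h"
      by (simp add: grouplikeD[OF g] grouplikeD[OF h]
          tensor_map_of_pure[OF B_module B_module Hm Hm p_linear p_linear]
          p_grouplike_eq[OF g h])
  qed (use assms grouplikeD(1) in \<open>auto simp: reduction_ideal_def\<close>)
  then show ?thesis by simp
qed

lemma counit_vanish:
  assumes "x \<in> I"
  shows "\<epsilon> x = \<zero>"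
  using assms grouplikeD(1,3) unfolding reduction_ideal_def
  by (intro ring_hom_zero_on_difference_ideal[OF A.ring_axioms R.ring_axioms counit_hom, of
      "grouplikes R B \<Delta> \<epsilon>"]) auto

sublocale Q: bialgebra_quotient R B \<Delta> \<epsilon> H p D e
proof -
  interpret H: assoc_algebra R H by (rule H_algebra)
  have Hm: "module R H" ..
  have HH: "module R (tensor R H H)" by (intro tensor_is_module Hm)
  have "bialgebra_quotient_axioms R B \<Delta> \<epsilon> H p D e"
  proof
    fix x assume x: "x \<in> carrier B"
    show "D (p x) = tensor_map R H H p p (\<Delta> x)"
      unfolding reduced_comult_def reduction_def[of R B \<Delta> \<epsilon> x]
      by (intro linear_map_the_elem_coset[OF I_submodule HH] tensor_comult_vanish x
          linear_map_comp[OF comult_linear] tensor_map_is_linear B_module Hm p_linear)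
    show "e (p x) = \<epsilon> x"
      unfolding reduced_counit_def reduction_def
      by (rule linear_map_the_elem_coset[OF I_submodule regular_module_module[OF R.is_cring]
          counit_linear _ x])
        (simp add: counit_vanish regular_module_simps)
  qed (rule p_linear p_hom p_surj)+
  then show "bialgebra_quotient R B \<Delta> \<epsilon> H p D e"
    by (simp add: bialgebra_quotient_def bialgebra_axioms H_algebra)
qed

text \<open>The unit is semigrouplike: \<open>\<Delta>\<close> preserves it, and it is nonzero
  because \<open>B\<close> contains the nonzero element \<open>g\<close>. Both \<open>g\<close> and
  the unit are then grouplike, so their difference is a generator of \<open>I\<close>.\<close>

lemma p_semigrouplike:
  assumes "g \<in> semigrouplikes R B \<Delta>"
  shows "p g = \<one>\<^bsub>H\<^esub>"
proof -
  have "g \<in> carrier B" "g \<noteq> \<zero>\<^bsub>B\<^esub>" using assms by (auto simp: semigrouplikes_def)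
  then have "\<one>\<^bsub>B\<^esub> \<noteq> \<zero>\<^bsub>B\<^esub>" using A.l_one A.l_null by metis
  moreover have "\<Delta> \<one>\<^bsub>B\<^esub> = pure R B B \<one>\<^bsub>B\<^esub> \<one>\<^bsub>B\<^esub>"
  proof -
    interpret BB: two_algebras R B B by (intro two_algebrasI Q.algs)
    show ?thesis using ring_hom_one[OF comult_hom] by (simp add: BB.tensor_one)
  qed
  ultimately have "\<one>\<^bsub>B\<^esub> \<in> semigrouplikes R B \<Delta>" by (simp add: semigrouplikes_def)
  then show ?thesis
    using p_grouplike_eq[of g "\<one>\<^bsub>B\<^esub>"] assms grouplike ring_hom_one[OF p_hom] by auto
qed

section \<open>Local nilpotency along the quasi-filtration\<close>

abbreviation pw where "pw \<equiv> Q.H.conv_power Q.H.unit_minus_id"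

text \<open>As \<open>\<pi> g\<close> is the unit of \<open>H\<close>, the value is
  \<open>\<epsilon>(1) 1 - 1 = 0\<close>.\<close>

lemma unit_minus_id_semigrouplike:
  assumes "g \<in> semigrouplikes R B \<Delta>"
  shows "Q.H.unit_minus_id (p g) = \<zero>\<^bsub>H\<^esub>"
proof -
  have g: "g \<in> carrier B" "\<epsilon> g = \<one>" using assms grouplike grouplikeD by blast+
  have "p g \<in> carrier H" by (rule linear_map_closed[OF p_linear g(1)])
  then show ?thesis
    by (simp add: Q.H.unit_minus_id_def Q.H.conv_unit_def p_semigrouplike[OF assms] ring_hom_one[OF
        Q.H.counit_hom]
        Q.H.smult_minus_one Q.H.M.r_neg)
qed

lemma pw_linear: "linear_map R H H (pw m)"
  by (rule Q.H.conv_power_linear[OF Q.H.unit_minus_id_linear])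

text \<open>The exponent has to be positive: the power with exponent \<open>0\<close> is the
  convolution unit, which maps \<open>\<pi> g\<close> to \<open>1\<close>. A positive exponent
  brings in the factor \<open>P(\<pi> g)\<close>.\<close>

lemma pw_semigrouplike:
  assumes g: "g \<in> semigrouplikes R B \<Delta>"
  shows "pw (Suc m) (p g) = \<zero>\<^bsub>H\<^esub>"
proof -
  have gB: "g \<in> carrier B" and \<Delta>g: "\<Delta> g = pure R B B g g" using g by (auto simp: semigrouplikes_def)
  show ?thesis
    using linear_map_closed[OF pw_linear linear_map_closed[OF p_linear gB], of m]
    by (simp add: Q.conv_p[OF Q.H.unit_minus_id_linear pw_linear gB] \<Delta>g unit_minus_id_semigrouplike[OF g]
        lift_pure[OF B_module B_module Q.mods(2) bilinear_map_comp[OF Q.H.conv_bilinear[OF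
            Q.H.unit_minus_id_linear pw_linear]
        p_linear p_linear]] gB)
qed

lemma pw_quasi_filtration:
  assumes "g \<in> semigrouplikes R B \<Delta>" "h \<in> semigrouplikes R B \<Delta>" "x \<in> quasi_filtration R B \<Delta> n g h" "n < m"
  shows "pw m (p x) = \<zero>\<^bsub>H\<^esub>"
  using assms
proof (induction n arbitrary: g h x m)
  case 0
  \<comment> \<open>Stage \<open>0\<close> consists of multiples of \<open>g\<close>, and
    \<open>n < m\<close> makes the exponent positive.\<close>
  then obtain a k where a: "a \<in> carrier R" "x = a \<odot>\<^bsub>B\<^esub> g" and m: "m = Suc k"
    by (cases m) auto
  have g: "g \<in> carrier B" using 0 by (simp add: semigrouplikes_def)
  show ?case
    using a g m pw_semigrouplike[OF 0(1)] linear_map_closed[OF p_linear g]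
    by (simp add: linear_map_smult[OF p_linear] linear_map_smult[OF pw_linear] del: Q.H.conv_power.simps)
next
  case (Suc n)
  then obtain k where m: "m = Suc k" and k: "n < k" by (cases m) auto
  \<comment> \<open>Applied to \<open>\<Delta> x\<close> this map gives \<open>P^m(\<pi> x)\<close>,
    so the claim becomes a computation of \<open>?L\<close> on the three parts of
    \<open>\<Delta> x\<close>.\<close>
  let ?L = "tensor_lift R H (\<lambda>y z. Q.H.unit_minus_id (p y) \<otimes>\<^bsub>H\<^esub> pw k (p z))"
  let ?BB = "tensor R B B"
  have BBm: "module R ?BB" by (intro tensor_is_module B_module)
  interpret BB: module R ?BB by (rule BBm)
  have bil: "bilinear_map R B B H (\<lambda>y z. Q.H.unit_minus_id (p y) \<otimes>\<^bsub>H\<^esub> pw k (p z))"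
    by (rule bilinear_map_comp[OF Q.H.conv_bilinear[OF Q.H.unit_minus_id_linear pw_linear] p_linear
        p_linear])
  note L = lift_linear[OF B_module B_module Q.mods(2) bil]
  note L_pure = lift_pure[OF B_module B_module Q.mods(2) bil]
  note c = linear_map_closed[OF Q.H.unit_minus_id_linear linear_map_closed[OF p_linear]]
    linear_map_closed[OF pw_linear linear_map_closed[OF p_linear]]
  have gh: "g \<in> carrier B" "h \<in> carrier B" using Suc by (auto simp: semigrouplikes_def)
  let ?U = "\<Union>t\<in>semigrouplikes R B \<Delta>.
               box_tensor R B (quasi_filtration R B \<Delta> n g t) (quasi_filtration R B \<Delta> n t h)"
  have x: "x \<in> carrier B" and d: "\<Delta> x \<ominus>\<^bsub>?BB\<^esub> pure R B B g x \<ominus>\<^bsub>?BB\<^esub> pure R B B x h \<in> submodule_span R ?BB ?U"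
    using Suc.prems(3) by simp_all
  have "?U \<subseteq> {u \<in> carrier ?BB. ?L u = \<zero>\<^bsub>H\<^esub>}"
  proof
    fix u assume "u \<in> ?U"
    then obtain t N y z where t: "t \<in> semigrouplikes R B \<Delta>"
      and u: "u = (\<Oplus>\<^bsub>?BB\<^esub>i\<in>{..<N::nat}. pure R B B (y i) (z i))"
      and yz: "\<And>i. i < N \<Longrightarrow> y i \<in> quasi_filtration R B \<Delta> n g t"
        "\<And>i. i < N \<Longrightarrow> z i \<in> quasi_filtration R B \<Delta> n t h"
      by (auto simp: box_tensor_def)
    have tB: "t \<in> carrier B" using t by (simp add: semigrouplikes_def)
    have yzB: "y i \<in> carrier B" "z i \<in> carrier B" if "i < N" for i
      using yz[OF that] quasi_filtration_subset[OF B_module] gh tB by blast+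
    have pB: "pure R B B (y i) (z i) \<in> carrier ?BB" if "i < N" for i
      using yzB[OF that] by (intro pure_in_tensor B_module)
    have "?L u = (\<Oplus>\<^bsub>H\<^esub>i\<in>{..<N}. ?L (pure R B B (y i) (z i)))"
      unfolding u by (rule linear_map_finsum[OF BBm Q.mods(2) L]) (auto intro: pB)
    also have "\<dots> = (\<Oplus>\<^bsub>H\<^esub>i\<in>{..<N}. \<zero>\<^bsub>H\<^esub>)"
      \<comment> \<open>The right factors suffice: \<open>z i\<close> lies in stage \<open>n\<close>
        between \<open>t\<close> and \<open>h\<close>, and \<open>n < k\<close>, so the induction
        hypothesis kills its image.\<close>
      using yzB Suc.IH[OF t Suc.prems(2) yz(2) k] c by (intro Q.H.M.finsum_cong') (auto simp: L_pure)
    finally have "?L u = \<zero>\<^bsub>H\<^esub>" by simp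
    moreover have "u \<in> carrier ?BB" unfolding u by (intro BB.finsum_closed) (auto intro: pB)
    ultimately show "u \<in> {u \<in> carrier ?BB. ?L u = \<zero>\<^bsub>H\<^esub>}" by simp
  qed
  then have "submodule_span R ?BB ?U \<subseteq> {u \<in> carrier ?BB. ?L u = \<zero>\<^bsub>H\<^esub>}"
    by (rule submodule_span_least[OF linear_map_ker_submodule[OF BBm Q.mods(2) L]])
  then have eq: "?L (\<Delta> x \<ominus>\<^bsub>?BB\<^esub> pure R B B g x \<ominus>\<^bsub>?BB\<^esub> pure R B B x h) = \<zero>\<^bsub>H\<^esub>"
    using d by blast
  have pure: "pure R B B g x \<in> carrier ?BB" "pure R B B x h \<in> carrier ?BB"
    using gh x by (auto intro: pure_in_tensor B_module)
  \<comment> \<open>Positivity of \<open>k\<close> comes from \<open>n < k\<close>, and matters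
    already for \<open>n = 0\<close>: the power with exponent \<open>0\<close> would not kill
    \<open>\<pi> h\<close>. This is why the bound on the exponent is strict.\<close>
  obtain j where "k = Suc j" using k by (cases k) auto
  then have "pw k (p h) = \<zero>\<^bsub>H\<^esub>" using pw_semigrouplike[OF Suc.prems(2)] by simp
  then have "?L (pure R B B g x) = \<zero>\<^bsub>H\<^esub>" "?L (pure R B B x h) = \<zero>\<^bsub>H\<^esub>"
    using gh x c
    by (simp_all add: L_pure unit_minus_id_semigrouplike[OF Suc.prems(1)] del: Q.H.conv_power.simps)
  with eq have "?L (\<Delta> x) = \<zero>\<^bsub>H\<^esub>"
    using pure comult_closed[OF x] linear_map_closed[OF L comult_closed[OF x]]
    by (simp add: linear_map_diff[OF BBm Q.mods(2) L] a_minus_def[of H])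
  then show ?case
    by (simp add: m Q.conv_p[OF Q.H.unit_minus_id_linear pw_linear x])
qed

text \<open>The bound on the exponent does not depend on \<open>g\<close> and \<open>h\<close>, so
  the kernel of one power contains all the summands and hence their span.\<close>

lemma pw_total_quasi_filtration:
  assumes "x \<in> total_quasi_filtration R B \<Delta> n" "n < m"
  shows "pw m (p x) = \<zero>\<^bsub>H\<^esub>"
proof -
  have "quasi_filtration R B \<Delta> n g h \<subseteq> carrier B" if "g \<in> semigrouplikes R B \<Delta>" for g h
    using that by (intro quasi_filtration_subset B_module) (simp add: semigrouplikes_def)
  then have "total_quasi_filtration R B \<Delta> n \<subseteq> {x \<in> carrier B. pw m (p x) = \<zero>\<^bsub>H\<^esub>}"
    unfolding total_quasi_filtration_def
    by (intro submodule_span_least linear_map_ker_submodule B_module Q.mods(2)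
        linear_map_comp[OF p_linear pw_linear])
      (use pw_quasi_filtration assms(2) in blast)
  then show ?thesis using assms(1) by blast
qed

text \<open>Each element of \<open>H\<close> has a preimage in some stage of the quasi-filtration of
  \<open>B\<close>, and the index of that stage bounds the exponents whose powers can be nonzero at
  it.\<close>

lemma reduced_hopf_algebra:
  assumes "sg_flavored R B \<Delta>"
  shows "hopf_algebra R H D e"
proof (rule Q.H.hopf_algebra_if_locally_nilpotent)
  fix y assume "y \<in> carrier H"
  then obtain x where x: "x \<in> carrier B" "y = p x" using p_surj by auto
  obtain n where "x \<in> total_quasi_filtration R B \<Delta> n"
    using x(1) assms by (auto simp: sg_flavored_def)
  then have "\<forall>m\<ge>Suc n. pw m y = \<zero>\<^bsub>H\<^esub>"
    using pw_total_quasi_filtration x(2) by (simp add: Suc_le_eq del: Q.H.conv_power.simps)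
  then show "\<exists>n. \<forall>m\<ge>n. pw m y = \<zero>\<^bsub>H\<^esub>" ..
qed

end

theorem proposition3p18:
  fixes R :: "('r, 'k) ring_scheme"
    and B :: "('r, 'b, 'm) module_scheme"
    and \<Delta> :: "'b \<Rightarrow> ('b \<times> 'b \<Rightarrow> 'r) set"
    and \<epsilon> :: "'b \<Rightarrow> 'r"
  assumes "bialgebra R B \<Delta> \<epsilon>"
    and "split_sg_flavored R B \<Delta>"
    and "semigrouplikes R B \<Delta> \<subseteq> grouplikes R B \<Delta> \<epsilon>"
  shows "hopf_coaction R
           (reduced_algebra R B \<Delta> \<epsilon>) (reduced_comult R B \<Delta> \<epsilon>) (reduced_counit R B \<Delta> \<epsilon>)
           B (brown_map R B \<Delta> \<epsilon>)"
proof -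
  interpret grouplike_bialgebra R B \<Delta> \<epsilon>
    using assms(1,3) by (simp add: grouplike_bialgebra_def grouplike_bialgebra_axioms_def)
  show ?thesis
    using Q.quotient_hopf_coaction[OF reduced_hopf_algebra] assms(2)
    by (simp add: split_sg_flavored_def brown_map_def[abs_def])
qed

end
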